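(* Suppose that the true regression function $f^\star$ is in a Sobolev space of index $\beta>\frac12$, i.e., $f^\star=f_{\theta^\star}$ for an infinite coefficient vector $\theta^\star$ with $\sum_{j=1}^\infty\theta_j^{\star2}j^{2\beta}\lesssim1$. Then, for the empirical prior defined in the context (with any fixed $\gamma\in(0,1)$), there exists a constant $M>0$ such that the corresponding posterior distribution $\Pi^n$, using Type 1 or Type 2 regularization with any $\alpha\in(0,1)$, satisfies, as $n\to\infty$, $$\mathsf{E}_{f^\star}^n\bigl[\Pi^n(\{\theta:\|f_\theta-f^\star\|_n>M\,n^{-\beta/(2\beta+1)}\})\bigr]\to0.$$
   Context: Model: $Y_i=f(t_i)+\sigma z_i$, $i=1,\dots,n$, with $z_1,\dots,z_n$ iid $\mathsf{N}(0,1)$, $\sigma>0$ fixed and known, $t_i=i/n$, and $f$ an unknown function on $[0,1]$. Write $f=f_\theta$, $f_\theta(t)=\sum_{j=1}^\infty\theta_j\phi_j(t)$, where $(\phi_1,\phi_2,\dots)$ is the (standard, orthonormal) Fourier basis of $L^2[0,1]$ and $\theta=(\theta_1,\theta_2,\dots)$ are the coefficients. $\mathsf{E}_{f^\star}^n$ is expectation under the joint distribution of $Y=(Y_1,\dots,Y_n)^\top$ when $f=f^\star$, and $\|f\|_n^2=n^{-1}\sum_{i=1}^nf(t_i)^2$. $L_n(\theta)$ denotes the likelihood of $Y$ under $f_\theta$. Empirical prior: represent $\theta$ as $(S,\theta_S)$, with $S\in\{1,\dots,n\}$ an integer (so $|S|=S$) and $\theta_S=(\theta_1,\dots,\theta_S,0,0,\dots)$;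 $\Theta_{n,S}$ is the set of such vectors. The marginal prior for $S$ is $w_n(s)\propto e^{-g(s)s}$, $s=1,\dots,n$, where $g$ is a non-decreasing slowly varying function (this includes the constant choice $g(s)\equiv B$ for a sufficiently large constant $B$). Let $\Phi_S$ be the $n\times|S|$ matrix with entries $\phi_j(t_i)$, and let $\hat\theta_{n,S}=(\Phi_S^\top\Phi_S)^{-1}\Phi_S^\top Y$ be the least-squares estimator (the maximum likelihood estimator over $\Theta_{n,S}$). The conditional prior $\Pi_{n,S}$ of $\theta_S$ given $S$ is $\mathsf{N}_{|S|}\bigl(\hat\theta_{n,S},\gamma^{-1}(\Phi_S^\top\Phi_S)^{-1}\bigr)$ for the nonzero coordinates, $\gamma\in(0,1)$. The empirical prior is the mixture $\Pi_n=\sum_{S}w_n(S)\Pi_{n,S}$. Regularized (double empirical) priors, for $\alpha\in(0,1)$: Type 1: $\widetilde\Pi_n(d\theta)\propto\Pi_n(d\theta)/L_n(\theta)^{1-\alpha}$. Type 2: $\widetilde\Pi_n=\sum_S\widetilde w_n(S)\Pi_{n,S}$ with $\widetilde w_n(S)\propto w_n(S)/L_n(\hat\theta_{n,S})^{1-\alpha}$. The posterior is $\Pi^n(A)=\int_AL_n(\theta)\,\widetilde\Pi_n(d\theta)\big/\int L_n(\theta)\,\widetilde\Pi_n(d\theta)$.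
   Formalization: The penalty function g is additionally assumed bounded, with values eventually above a sufficiently large constant B; for every unbounded slowly varying g some f* in the Sobolev space violates the exact rate n^{-β/(2β+1)}. *)

theory Defs
  imports "HOL-Probability.Probability" "Jordan_Normal_Form.Gauss_Jordan_Elimination"
    "Jordan_Normal_Form.Determinant"
begin

text \<open>
  Coefficient sequences \<open>\<theta> :: nat \<Rightarrow> real\<close> and data \<open>Y :: nat \<Rightarrow> real\<close> are indexed from 1; the entry
  at 0 is never used. Vectors and matrices of Jordan Normal Form are indexed from 0, which accounts
  for the index shifts below.
\<close>

text \<open>
  The cosine precedes the sine of the same frequency: for even \<open>n\<close> the function
  \<open>sin (2 * pi * (n / 2) * t)\<close> vanishes at all design points \<open>i / n\<close>, and the opposite order would make
  the Gram matrix of size \<open>n\<close> singular.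
\<close>

definition fourier :: "nat \<Rightarrow> real \<Rightarrow> real" where
  "fourier j t =
     (if j \<le> 1 then 1
      else if even j then sqrt 2 * cos (2 * pi * real (j div 2) * t)
      else sqrt 2 * sin (2 * pi * real (j div 2) * t))"

definition fseries :: "(nat \<Rightarrow> real) \<Rightarrow> real \<Rightarrow> real" where
  "fseries \<theta> t = (\<Sum>j. \<theta> (Suc j) * fourier (Suc j) t)"

definition sobolev :: "real \<Rightarrow> (nat \<Rightarrow> real) set" where
  "sobolev \<beta> = {\<theta>. summable (\<lambda>j. (\<theta> (Suc j))\<^sup>2 * real (Suc j) powr (2 * \<beta>))}"

definition design :: "nat \<Rightarrow> nat \<Rightarrow> real" where
  "design n i = real i / real n"

definition emp_norm :: "nat \<Rightarrow> (real \<Rightarrow> real) \<Rightarrow> real" where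
  "emp_norm n f = sqrt ((\<Sum>i=1..n. (f (design n i))\<^sup>2) / real n)"

definition data_law :: "real \<Rightarrow> nat \<Rightarrow> (real \<Rightarrow> real) \<Rightarrow> (nat \<Rightarrow> real) measure" where
  "data_law \<sigma> n f =
     (\<Pi>\<^sub>M i\<in>{1..n}. density lborel (\<lambda>y. ennreal (normal_density (f (design n i)) \<sigma> y)))"

definition likelihood :: "real \<Rightarrow> nat \<Rightarrow> (nat \<Rightarrow> real) \<Rightarrow> (nat \<Rightarrow> real) \<Rightarrow> real" where
  "likelihood \<sigma> n Y \<theta> = (\<Prod>i=1..n. normal_density (fseries \<theta> (design n i)) \<sigma> (Y i))"

text \<open>
  In the penalty \<open>g s * s\<close> an unbounded slowly varying \<open>g\<close> such as \<open>ln\<close> costs a power of \<open>g\<close> in the rate: some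
  Sobolev sequences are then recovered only at a rate slower than \<open>n powr (- \<beta> / (2 * \<beta> + 1))\<close>. Results
  on the exact rate therefore need \<open>g\<close> bounded in addition, with a sufficiently large limit.
\<close>

definition slowly_varying :: "(real \<Rightarrow> real) \<Rightarrow> bool" where
  "slowly_varying g \<longleftrightarrow>
     (\<forall>\<^sub>F x in at_top. g x > 0) \<and> (\<forall>c>0. ((\<lambda>x. g (c * x) / g x) \<longlongrightarrow> 1) at_top)"

definition mat_inv :: "real mat \<Rightarrow> real mat" where
  "mat_inv A = the (mat_inverse A)"

definition design_mat :: "nat \<Rightarrow> nat \<Rightarrow> real mat" where
  "design_mat n s = Matrix.mat n s (\<lambda>(i, j). fourier (Suc j) (design n (Suc i)))"

definition gram_mat :: "nat \<Rightarrow> nat \<Rightarrow> real mat" where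
  "gram_mat n s = transpose_mat (design_mat n s) * design_mat n s"

definition lse :: "nat \<Rightarrow> nat \<Rightarrow> (nat \<Rightarrow> real) \<Rightarrow> real Matrix.vec" where
  "lse n s Y =
     mat_inv (gram_mat n s) *\<^sub>v (transpose_mat (design_mat n s) *\<^sub>v Matrix.vec n (\<lambda>i. Y (Suc i)))"

definition zero_pad :: "real Matrix.vec \<Rightarrow> nat \<Rightarrow> real" where
  "zero_pad v = (\<lambda>j. if j \<in> {1..dim_vec v} then vec_index v (j - 1) else 0)"

definition mvn_density :: "real Matrix.vec \<Rightarrow> real mat \<Rightarrow> real Matrix.vec \<Rightarrow> real" where
  "mvn_density \<mu> C x =
     exp (- scalar_prod (x - \<mu>) (mat_inv C *\<^sub>v (x - \<mu>)) / 2)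
       / sqrt ((2 * pi) ^ dim_vec \<mu> * Determinant.det C)"

abbreviation seq_space :: "(nat \<Rightarrow> real) measure" where
  "seq_space \<equiv> (\<Pi>\<^sub>M j\<in>UNIV. borel)"

definition cond_prior :: "real \<Rightarrow> nat \<Rightarrow> (nat \<Rightarrow> real) \<Rightarrow> nat \<Rightarrow> (nat \<Rightarrow> real) measure" where
  "cond_prior \<gamma> n Y s =
     distr
       (density (\<Pi>\<^sub>M j\<in>{1..s}. lborel)
          (\<lambda>x. ennreal (mvn_density (lse n s Y) ((1 / \<gamma>) \<cdot>\<^sub>m mat_inv (gram_mat n s))
                          (Matrix.vec s (\<lambda>k. x (Suc k))))))
       seq_space
       (\<lambda>x. zero_pad (Matrix.vec s (\<lambda>k. x (Suc k))))"

definition normalize_weights :: "nat \<Rightarrow> (nat \<Rightarrow> real) \<Rightarrow> nat \<Rightarrow> real" where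
  "normalize_weights n u s = u s / (\<Sum>r=1..n. u r)"

definition mixture ::
  "nat \<Rightarrow> (nat \<Rightarrow> real) \<Rightarrow> (nat \<Rightarrow> (nat \<Rightarrow> real) measure) \<Rightarrow> (nat \<Rightarrow> real) measure" where
  "mixture n w K =
     measure_of (space seq_space) (sets seq_space)
       (\<lambda>A. \<Sum>s=1..n. ennreal (w s) * emeasure (K s) A)"

definition size_prior :: "(real \<Rightarrow> real) \<Rightarrow> nat \<Rightarrow> nat \<Rightarrow> real" where
  "size_prior g n = normalize_weights n (\<lambda>s. exp (- g (real s) * real s))"

definition emp_prior ::
  "real \<Rightarrow> (real \<Rightarrow> real) \<Rightarrow> nat \<Rightarrow> (nat \<Rightarrow> real) \<Rightarrow> (nat \<Rightarrow> real) measure" where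
  "emp_prior \<gamma> g n Y = mixture n (size_prior g n) (cond_prior \<gamma> n Y)"

text \<open>
  Type 1 regularization is left unnormalized. The measure may have infinite mass (if
  \<open>\<gamma> < (1 - \<alpha>) / \<sigma>\<^sup>2\<close>), so that there is nothing to normalize by, and the posterior does not depend on the
  normalizing constant.
\<close>

definition type1_prior ::
  "real \<Rightarrow> real \<Rightarrow> (real \<Rightarrow> real) \<Rightarrow> real \<Rightarrow> nat \<Rightarrow> (nat \<Rightarrow> real) \<Rightarrow> (nat \<Rightarrow> real) measure" where
  "type1_prior \<sigma> \<gamma> g \<alpha> n Y =
     density (emp_prior \<gamma> g n Y) (\<lambda>\<theta>. ennreal (1 / likelihood \<sigma> n Y \<theta> powr (1 - \<alpha>)))"

definition type2_prior ::
  "real \<Rightarrow> real \<Rightarrow> (real \<Rightarrow> real) \<Rightarrow> real \<Rightarrow> nat \<Rightarrow> (nat \<Rightarrow> real) \<Rightarrow> (nat \<Rightarrow> real) measure" where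
  "type2_prior \<sigma> \<gamma> g \<alpha> n Y =
     mixture n
       (normalize_weights n
          (\<lambda>s. size_prior g n s / likelihood \<sigma> n Y (zero_pad (lse n s Y)) powr (1 - \<alpha>)))
       (cond_prior \<gamma> n Y)"

definition posterior ::
  "real \<Rightarrow> nat \<Rightarrow> (nat \<Rightarrow> real) \<Rightarrow> (nat \<Rightarrow> real) measure \<Rightarrow> (nat \<Rightarrow> real) set \<Rightarrow> ennreal" where
  "posterior \<sigma> n Y P A =
     (\<integral>\<^sup>+\<theta>\<in>A. ennreal (likelihood \<sigma> n Y \<theta>) \<partial>P) / (\<integral>\<^sup>+\<theta>. ennreal (likelihood \<sigma> n Y \<theta>) \<partial>P)"

end

theory Submission
  imports Defs "HOL-Real_Asymp.Real_Asymp"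
begin

text \<open>
  On the design the first \<open>n\<close> Fourier functions are orthogonal, so in the coordinates \<open>coord n Y\<close> the
  prior of size \<open>s\<close> is a product of normals centred at the first \<open>s\<close> coordinates of the data, and for both
  regularizations the posterior is a mixture over \<open>s\<close> with weights proportional to
  \<open>exp (- g s * s - \<alpha> * resid n Y s / (2 * \<sigma>\<^sup>2))\<close> times the \<open>s\<close>-th power of a constant. Write \<open>r\<close> for \<open>n\<close> times
  the squared rate. For a fixed Sobolev sequence the bias at size \<open>\<delta> * r\<close> is \<open>o(r)\<close> for every \<open>\<delta> > 0\<close>, because
  the tail of the Sobolev norm tends to 0. Choosing \<open>\<delta>\<close> small depending on \<open>\<alpha>\<close> therefore costs nothing, and
  every \<open>M\<close>, in particular \<open>M = 1\<close>, works simultaneously for all \<open>\<alpha>\<close>. The noise enters only through chi-square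
  bounds \<open>\<chi>\<^sup>2(s) \<le> 8 * s\<close> for large \<open>s\<close>, whence \<open>B = 10\<close>.
\<close>

section \<open>Trigonometric sums over the design\<close>

text \<open>The denominator needs no estimate near the truth: since each conditional prior is
  centred at the least-squares estimator, its total mass after tilting by the likelihood is explicit
  and free of the data, so one size bounds the whole denominator from below. A size up to
  \<open>m\<close> with small bias is compared with itself, every other size with \<open>S\<close>.
  The two regularizations lead to the same weights and differ only in the factor \<open>a\<close> of
  the quadratic form \<open>qform\<close> in the exponent; all estimates are uniform over
  \<open>0 \<le> a \<le> 1 / (2 * \<sigma>\<^sup>2)\<close>. Origin of the constants: the
  exponential moment of the chi-square variable at 1/4 is \<open>sqrt 2 ^ s\<close>, at most
  \<open>exp s\<close>, so exceeding \<open>8 * s\<close> has probability at most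
  \<open>exp (- 2 * s) * exp s = exp (- s)\<close>, which is summable. In the log-ratio of two
  weights the noise then contributes at most \<open>8 * s\<close>, because \<sigma> cancels and
  \<alpha> < 1. One more unit of penalty pays for the comparison size \<open>S\<close>, and one is
  left to sum over \<open>s\<close>: 8 + 1 + 1 = 10.\<close>

lemma sq_add_le: "(x + y)\<^sup>2 \<le> 2 * x\<^sup>2 + 2 * (y::real)\<^sup>2"
  using sum_squares_bound[of x y] by (simp add: power2_sum)

text \<open>The summands are the powers of one \<open>n\<close>-th root of unity, so their geometric
  sum vanishes unless that root is 1. The frequency is an integer because product formulas produce
  differences.\<close>

lemma sum_cis_design:
  fixes m :: int
  assumes "n > 0"
  shows "(\<Sum>i=1..n. cis (2 * pi * of_int m * (real i / real n))) = (if int n dvd m then of_nat n else 0)"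
proof -
  define w where "w = cis (2 * pi * of_int m / real n)"
  have pw: "cis (2 * pi * of_int m * (real i / real n)) = w ^ i" for i
    unfolding w_def Complex.DeMoivre by (simp add: field_simps)
  have wn: "w ^ n = 1"
    using pw[of n] assms cis_multiple_2pi[of "of_int m"] by simp
  show ?thesis
  proof (cases "int n dvd m")
    case True
    then obtain k where k: "m = int n * k" by blast
    have "w = 1" unfolding w_def k using assms cis_multiple_2pi[of "of_int k"]
      by (simp add: mult.left_commute)
    then show ?thesis using True by (simp only: pw) simp
  next
    case False
    have w1: "w \<noteq> 1"
    proof
      assume "w = 1"
      then have "cos (2 * pi * of_int m / real n) = 1" unfolding w_def by (metis cis.sel(1) one_complex.sel(1))
      then obtain k :: int where "2 * pi * of_int m / real n = of_int k * 2 * pi" unfolding cos_one_2pi_int by blast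
      then have "real_of_int m = of_int (k * int n)" using assms by (simp add: field_simps)
      then have "m = k * int n" by linarith
      then show False using False by simp
    qed
    have "(\<Sum>i=1..n. w ^ i) = w * (\<Sum>i<n. w ^ i)"
      by (simp add: sum_distrib_left sum.atLeast1_atMost_eq)
    also have "(\<Sum>i<n. w ^ i) = 0" using geometric_sum[OF w1, of n] wn by simp
    finally show ?thesis using False by (simp only: pw) simp
  qed
qed

lemma sum_cos_design:
  fixes m :: int
  assumes "n > 0"
  shows "(\<Sum>i=1..n. cos (2 * pi * of_int m * (real i / real n))) = (if int n dvd m then real n else 0)"
  using arg_cong[OF sum_cis_design[OF assms, of m], of Re] by simp

lemma sum_sin_design:
  fixes m :: int
  assumes "n > 0"
  shows "(\<Sum>i=1..n. sin (2 * pi * of_int m * (real i / real n))) = 0"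
  using arg_cong[OF sum_cis_design[OF assms, of m], of Im] by (simp split: if_splits)

text \<open>The second divisibility condition is aliasing: on the design the cosines of frequency
  \<open>l\<close> and \<open>n - l\<close> coincide.\<close>

lemma sum_cos_cos_design:
  assumes "n > 0"
  shows "(\<Sum>i=1..n. cos (2 * pi * real k * (real i / real n)) * cos (2 * pi * real l * (real i / real n)))
    = ((if int n dvd int k - int l then real n else 0) + (if int n dvd int k + int l then real n else 0)) / 2"
proof -
  have "(\<Sum>i=1..n. cos (2 * pi * real k * (real i / real n)) * cos (2 * pi * real l * (real i / real n)))
    = (\<Sum>i=1..n. cos (2 * pi * of_int (int k - int l) * (real i / real n)) / 2
         + cos (2 * pi * of_int (int k + int l) * (real i / real n)) / 2)"
    by (intro sum.cong refl) (simp add: cos_times_cos algebra_simps add_divide_distrib diff_divide_distrib)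
  also have "\<dots> = ((if int n dvd int k - int l then real n else 0) + (if int n dvd int k + int l then real n else 0)) / 2"
    unfolding sum.distrib sum_divide_distrib[symmetric] sum_cos_design[OF assms] by simp
  finally show ?thesis .
qed

lemma sum_sin_sin_design:
  assumes "n > 0"
  shows "(\<Sum>i=1..n. sin (2 * pi * real k * (real i / real n)) * sin (2 * pi * real l * (real i / real n)))
    = ((if int n dvd int k - int l then real n else 0) - (if int n dvd int k + int l then real n else 0)) / 2"
proof -
  have "(\<Sum>i=1..n. sin (2 * pi * real k * (real i / real n)) * sin (2 * pi * real l * (real i / real n)))
    = (\<Sum>i=1..n. cos (2 * pi * of_int (int k - int l) * (real i / real n)) / 2
         - cos (2 * pi * of_int (int k + int l) * (real i / real n)) / 2)"
    by (intro sum.cong refl) (simp add: sin_times_sin algebra_simps add_divide_distrib diff_divide_distrib)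
  also have "\<dots> = ((if int n dvd int k - int l then real n else 0) - (if int n dvd int k + int l then real n else 0)) / 2"
    unfolding sum_subtractf sum_divide_distrib[symmetric] sum_cos_design[OF assms] by simp
  finally show ?thesis .
qed

lemma sum_cos_sin_design:
  assumes "n > 0"
  shows "(\<Sum>i=1..n. cos (2 * pi * real k * (real i / real n)) * sin (2 * pi * real l * (real i / real n))) = 0"
proof -
  have "(\<Sum>i=1..n. cos (2 * pi * real k * (real i / real n)) * sin (2 * pi * real l * (real i / real n)))
    = (\<Sum>i=1..n. sin (2 * pi * of_int (int k + int l) * (real i / real n)) / 2
         - sin (2 * pi * of_int (int k - int l) * (real i / real n)) / 2)"
    by (intro sum.cong refl) (simp add: cos_times_sin algebra_simps add_divide_distrib diff_divide_distrib)
  also have "\<dots> = 0"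
    unfolding sum_subtractf sum_divide_distrib[symmetric] sum_sin_design[OF assms] by simp
  finally show ?thesis .
qed

text \<open>For \<open>j\<close> in \<open>{1..n}\<close> the value is \<open>n\<close>, except that
  it is \<open>2 * n\<close> for \<open>j = n\<close> even, where the cosine alternates between
  \<open>sqrt 2\<close> and \<open>- sqrt 2\<close>. Hence columns are normalised individually
  rather than by \<open>n\<close>.\<close>

definition col_sq :: "nat \<Rightarrow> nat \<Rightarrow> real" where
  "col_sq n j = (\<Sum>i=1..n. (fourier j (design n i))\<^sup>2)"

text \<open>The constant function counts as the cosine of frequency 0, so
  \<open>even j \<or> j \<le> 1\<close> separates all cosines from all sines.\<close>

lemma fourier_cos: "even j \<or> j \<le> 1 \<Longrightarrow>
    fourier j t = (if j \<le> 1 then 1 else sqrt 2) * cos (2 * pi * real (j div 2) * t)"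
  by (auto simp: fourier_def)

lemma fourier_sin: "\<not> (even j \<or> j \<le> 1) \<Longrightarrow> fourier j t = sqrt 2 * sin (2 * pi * real (j div 2) * t)"
  by (auto simp: fourier_def)

lemma half_neq:
  fixes j k :: nat
  assumes "1 \<le> j" "1 \<le> k" "j \<noteq> k" "even j \<or> j \<le> 1 \<longleftrightarrow> even k \<or> k \<le> 1"
  shows "j div 2 \<noteq> k div 2"
  using assms by presburger

text \<open>This excludes aliasing through sums of frequencies. Distinctness matters: for
  \<open>j = k = n\<close> even the sum equals \<open>n\<close>.\<close>

lemma half_add_less:
  fixes j k n :: nat
  assumes "1 \<le> j" "1 \<le> k" "j \<le> n" "k \<le> n" "j \<noteq> k" "even j \<or> j \<le> 1 \<longleftrightarrow> even k \<or> k \<le> 1"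
  shows "j div 2 + k div 2 < n"
proof -
  have "j < k \<or> k < j" using assms by linarith
  then show ?thesis
  proof
    assume "j < k"
    then have "j div 2 + k div 2 < k" using assms by presburger
    then show ?thesis using assms by simp
  next
    assume "k < j"
    then have "j div 2 + k div 2 < j" using assms by presburger
    then show ?thesis using assms by simp
  qed
qed

lemma half_less_add: "j < k + n \<Longrightarrow> n > 0 \<Longrightarrow> j div 2 < k div 2 + (n::nat)"
  by linarith

text \<open>A cosine and a sine are orthogonal at any frequencies. Within one class neither the
  difference nor the sum of the frequencies is a multiple of \<open>n\<close>, so both aliasing
  terms vanish.\<close>

lemma fourier_orthogonal:
  assumes j: "j \<in> {1..n}" and k: "k \<in> {1..n}" and "j \<noteq> k"
  shows "(\<Sum>i=1..n. fourier j (design n i) * fourier k (design n i)) = 0"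
proof -
  have n: "n > 0" using j by simp
  let ?a = "\<lambda>j::nat. if j \<le> 1 then 1 else sqrt 2"
  have same: "\<not> int n dvd int (j div 2) - int (k div 2) \<and> \<not> int n dvd int (j div 2) + int (k div 2)"
    if "even j \<or> j \<le> 1 \<longleftrightarrow> even k \<or> k \<le> 1"
  proof -
    have jk: "1 \<le> j" "j \<le> n" "1 \<le> k" "k \<le> n" using j k by auto
    have "j div 2 \<noteq> k div 2" using half_neq[OF jk(1,3) assms(3) that] .
    moreover have "j div 2 + k div 2 < n" using half_add_less[OF jk(1,3,2,4) assms(3) that] .
    ultimately show ?thesis
      using zdvd_not_zless[of "int (j div 2) - int (k div 2)" "int n"]
        zdvd_not_zless[of "int (k div 2) - int (j div 2)" "int n"]
        zdvd_not_zless[of "int (j div 2) + int (k div 2)" "int n"]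
      by (smt (verit) dvd_minus_iff of_nat_add of_nat_eq_iff of_nat_less_iff of_nat_0_le_iff minus_diff_eq)
  qed
  consider (cc) "even j \<or> j \<le> 1" "even k \<or> k \<le> 1" | (cs) "even j \<or> j \<le> 1" "\<not> (even k \<or> k \<le> 1)"
    | (sc) "\<not> (even j \<or> j \<le> 1)" "even k \<or> k \<le> 1" | (ss) "\<not> (even j \<or> j \<le> 1)" "\<not> (even k \<or> k \<le> 1)"
    by blast
  then show ?thesis
  proof cases
    case cc
    have "(\<Sum>i=1..n. fourier j (design n i) * fourier k (design n i)) = ?a j * ?a k *
      (\<Sum>i=1..n. cos (2 * pi * real (j div 2) * (real i / real n)) * cos (2 * pi * real (k div 2) * (real i / real n)))"
      unfolding fourier_cos[OF cc(1)] fourier_cos[OF cc(2)] design_def sum_distrib_left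
      by (simp add: algebra_simps)
    then show ?thesis unfolding sum_cos_cos_design[OF n] using same cc by simp
  next
    case ss
    have sqrt2: "sqrt 2 * a * (sqrt 2 * b) = 2 * (a * b)" for a b :: real
    proof -
      have "sqrt 2 * a * (sqrt 2 * b) = (sqrt 2 * sqrt 2) * (a * b)" by (simp only: mult_ac)
      then show ?thesis by simp
    qed
    have "(\<Sum>i=1..n. fourier j (design n i) * fourier k (design n i)) = 2 *
      (\<Sum>i=1..n. sin (2 * pi * real (j div 2) * (real i / real n)) * sin (2 * pi * real (k div 2) * (real i / real n)))"
      unfolding fourier_sin[OF ss(1)] fourier_sin[OF ss(2)] design_def sum_distrib_left sqrt2 ..
    then show ?thesis unfolding sum_sin_sin_design[OF n] using same ss by simp
  next
    case cs
    have "(\<Sum>i=1..n. fourier j (design n i) * fourier k (design n i)) = ?a j * sqrt 2 *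
      (\<Sum>i=1..n. cos (2 * pi * real (j div 2) * (real i / real n)) * sin (2 * pi * real (k div 2) * (real i / real n)))"
      unfolding fourier_cos[OF cs(1)] fourier_sin[OF cs(2)] design_def sum_distrib_left
      by (simp add: algebra_simps)
    then show ?thesis unfolding sum_cos_sin_design[OF n] by simp
  next
    case sc
    have "(\<Sum>i=1..n. fourier j (design n i) * fourier k (design n i)) = ?a k * sqrt 2 *
      (\<Sum>i=1..n. cos (2 * pi * real (k div 2) * (real i / real n)) * sin (2 * pi * real (j div 2) * (real i / real n)))"
      unfolding fourier_cos[OF sc(2)] fourier_sin[OF sc(1)] design_def sum_distrib_left
      by (simp add: algebra_simps)
    then show ?thesis unfolding sum_cos_sin_design[OF n] by simp
  qed
qed

text \<open>Every cosine is nonzero at the last design point \<open>t = 1\<close>. Sines vanish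
  there, so their sum is evaluated: twice the frequency is \<open>j - 1\<close>, which lies strictly
  between 0 and \<open>n\<close>.\<close>

lemma col_sq_pos:
  assumes j: "j \<in> {1..n}"
  shows "col_sq n j > 0"
proof -
  have n: "n > 0" using j by simp
  show ?thesis
  proof (cases "even j \<or> j \<le> 1")
    case True
    have "fourier j (design n n) \<noteq> 0"
    proof -
      have "cos (2 * pi * real (j div 2)) = 1" using cos_int_2pin[of "int (j div 2)"] by simp
      then show ?thesis using n unfolding fourier_cos[OF True] design_def by simp
    qed
    then have "0 < (fourier j (design n n))\<^sup>2" by simp
    also have "\<dots> \<le> col_sq n j" unfolding col_sq_def using n
      by (intro member_le_sum) auto
    finally show ?thesis .
  next
    case False
    have "col_sq n j = 2 * (\<Sum>i=1..n. sin (2 * pi * real (j div 2) * (real i / real n)) * sin (2 * pi * real (j div 2) * (real i / real n)))"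
      unfolding col_sq_def fourier_sin[OF False] design_def sum_distrib_left by (simp add: power_mult_distrib power2_eq_square[of "sin _"])
    moreover have "\<not> int n dvd int (j div 2) + int (j div 2)"
    proof -
      have "j div 2 + j div 2 < n" "0 < j div 2" using j False by (auto elim!: oddE)
      then show ?thesis using zdvd_not_zless[of "int (j div 2) + int (j div 2)" "int n"] by linarith
    qed
    ultimately show ?thesis unfolding sum_sin_sin_design[OF n] using n by simp
  qed
qed

text \<open>Parseval for complex exponentials. Either quadratic form alone contains sums of
  frequencies, which may alias once indices exceed \<open>n\<close>; in the total they cancel by the
  formula for \<open>cos (x - y)\<close>, and distinctness modulo \<open>n\<close> suffices.\<close>

lemma frequency_block:
  fixes c :: "nat \<Rightarrow> real" and f :: "nat \<Rightarrow> nat"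
  assumes n: "n > 0" and J: "finite J"
    and dist: "\<And>j k. j \<in> J \<Longrightarrow> k \<in> J \<Longrightarrow> j \<noteq> k \<Longrightarrow> \<not> int n dvd int (f j) - int (f k)"
  shows "(\<Sum>i=1..n. (\<Sum>j\<in>J. c j * cos (2 * pi * real (f j) * (real i / real n)))\<^sup>2)
       + (\<Sum>i=1..n. (\<Sum>j\<in>J. c j * sin (2 * pi * real (f j) * (real i / real n)))\<^sup>2) = real n * (\<Sum>j\<in>J. (c j)\<^sup>2)"
proof -
  have "(\<Sum>i=1..n. (\<Sum>j\<in>J. c j * cos (2 * pi * real (f j) * (real i / real n)))\<^sup>2)
       + (\<Sum>i=1..n. (\<Sum>j\<in>J. c j * sin (2 * pi * real (f j) * (real i / real n)))\<^sup>2)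
     = (\<Sum>i=1..n. \<Sum>j\<in>J. \<Sum>k\<in>J. c j * c k * cos (2 * pi * of_int (int (f j) - int (f k)) * (real i / real n)))"
    unfolding power2_eq_square sum_product sum.distrib[symmetric]
    by (intro sum.cong refl) (simp add: cos_diff left_diff_distrib right_diff_distrib diff_divide_distrib algebra_simps)
  also have "\<dots> = (\<Sum>j\<in>J. \<Sum>k\<in>J. c j * c k * (\<Sum>i=1..n. cos (2 * pi * of_int (int (f j) - int (f k)) * (real i / real n))))"
    unfolding sum_distrib_left
    by (rule trans[OF sum.swap], rule sum.cong[OF refl], rule sum.swap)
  also have "\<dots> = (\<Sum>j\<in>J. \<Sum>k\<in>J. if k = j then c j * c k * real n else 0)"
    unfolding sum_cos_design[OF n] using dist by (intro sum.cong refl) auto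
  also have "\<dots> = real n * (\<Sum>j\<in>J. (c j)\<^sup>2)"
    using J by (simp add: sum_distrib_left power2_eq_square algebra_simps)
  finally show ?thesis .
qed

text \<open>Among \<open>n\<close> consecutive indices the frequencies of one class are distinct
  modulo \<open>n\<close>. The factor 4 is 2 for the squared normalisation \<open>sqrt 2\<close>
  times 2 for separating cosines from sines.\<close>

lemma fourier_block_le:
  fixes c :: "nat \<Rightarrow> real"
  assumes n: "n > 0" and J: "J \<subseteq> {Suc m..m + n}"
  shows "(\<Sum>i=1..n. (\<Sum>j\<in>J. c j * fourier j (design n i))\<^sup>2) \<le> 4 * real n * (\<Sum>j\<in>J. (c j)\<^sup>2)"
proof -
  have fin: "finite J" using J finite_subset by blast
  define C where "C = {j\<in>J. even j \<or> j \<le> 1}"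
  define S where "S = {j\<in>J. \<not> (even j \<or> j \<le> 1)}"
  have JCS: "J = C \<union> S" "C \<inter> S = {}" "finite C" "finite S" using fin by (auto simp: C_def S_def)
  let ?a = "\<lambda>j::nat. if j \<le> 1 then 1 else sqrt 2"
  have range: "\<not> int n dvd int (j div 2) - int (k div 2)"
    if "j \<in> J" "k \<in> J" "j \<noteq> k" "even j \<or> j \<le> 1 \<longleftrightarrow> even k \<or> k \<le> 1" for j k
  proof -
    have "m < j" "j \<le> m + n" "m < k" "k \<le> m + n" using that J by auto
    then have "j div 2 \<noteq> k div 2" "j div 2 < k div 2 + n" "k div 2 < j div 2 + n"
      using half_neq[OF _ _ that(3,4)] half_less_add[of j k n] half_less_add[of k j n] n by auto
    then show ?thesis
      using zdvd_not_zless[of "int (j div 2) - int (k div 2)" "int n"]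
        zdvd_not_zless[of "int (k div 2) - int (j div 2)" "int n"]
      by (smt (verit) dvd_minus_iff of_nat_add of_nat_eq_iff of_nat_less_iff of_nat_0_le_iff minus_diff_eq)
  qed
  have A: "(\<Sum>i=1..n. (\<Sum>j\<in>C. c j * fourier j (design n i))\<^sup>2) \<le> 2 * real n * (\<Sum>j\<in>C. (c j)\<^sup>2)"
  proof -
    have "(\<Sum>i=1..n. (\<Sum>j\<in>C. c j * fourier j (design n i))\<^sup>2)
        = (\<Sum>i=1..n. (\<Sum>j\<in>C. (c j * ?a j) * cos (2 * pi * real (j div 2) * (real i / real n)))\<^sup>2)"
      unfolding design_def using fourier_cos by (intro sum.cong arg_cong[where f="\<lambda>x. x\<^sup>2"] refl) (auto simp: C_def)
    \<comment> \<open>The form of the sines with the same coefficients and frequencies is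
      nonnegative, so it may be added.\<close>
    also have "\<dots> \<le> real n * (\<Sum>j\<in>C. (c j * ?a j)\<^sup>2)"
      using frequency_block[OF n JCS(3), of "\<lambda>j. j div 2" "\<lambda>j. c j * ?a j"] range
      by (smt (verit, best) C_def mem_Collect_eq sum_nonneg zero_le_power2)
    also have "\<dots> \<le> real n * (\<Sum>j\<in>C. 2 * (c j)\<^sup>2)"
      by (intro mult_left_mono sum_mono) (auto simp: power_mult_distrib)
    finally show ?thesis by (simp add: sum_distrib_left[symmetric])
  qed
  have B: "(\<Sum>i=1..n. (\<Sum>j\<in>S. c j * fourier j (design n i))\<^sup>2) \<le> 2 * real n * (\<Sum>j\<in>S. (c j)\<^sup>2)"
  proof -
    have "(\<Sum>i=1..n. (\<Sum>j\<in>S. c j * fourier j (design n i))\<^sup>2)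
        = (\<Sum>i=1..n. (\<Sum>j\<in>S. (c j * sqrt 2) * sin (2 * pi * real (j div 2) * (real i / real n)))\<^sup>2)"
      unfolding design_def using fourier_sin by (intro sum.cong arg_cong[where f="\<lambda>x. x\<^sup>2"] refl) (auto simp: S_def)
    also have "\<dots> \<le> real n * (\<Sum>j\<in>S. (c j * sqrt 2)\<^sup>2)"
      using frequency_block[OF n JCS(4), of "\<lambda>j. j div 2" "\<lambda>j. c j * sqrt 2"] range
      by (smt (verit, best) S_def mem_Collect_eq sum_nonneg zero_le_power2)
    finally show ?thesis by (simp add: power_mult_distrib sum_distrib_left algebra_simps)
  qed
  have "(\<Sum>i=1..n. (\<Sum>j\<in>J. c j * fourier j (design n i))\<^sup>2)
     \<le> (\<Sum>i=1..n. 2 * (\<Sum>j\<in>C. c j * fourier j (design n i))\<^sup>2 + 2 * (\<Sum>j\<in>S. c j * fourier j (design n i))\<^sup>2)"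
  proof (intro sum_mono)
    fix i
    have "(\<Sum>j\<in>J. c j * fourier j (design n i)) = (\<Sum>j\<in>C. c j * fourier j (design n i)) + (\<Sum>j\<in>S. c j * fourier j (design n i))"
      using JCS by (simp add: sum.union_disjoint)
    then show "(\<Sum>j\<in>J. c j * fourier j (design n i))\<^sup>2
       \<le> 2 * (\<Sum>j\<in>C. c j * fourier j (design n i))\<^sup>2 + 2 * (\<Sum>j\<in>S. c j * fourier j (design n i))\<^sup>2" by (simp only: sq_add_le)
  qed
  also have "\<dots> = 2 * (\<Sum>i=1..n. (\<Sum>j\<in>C. c j * fourier j (design n i))\<^sup>2) + 2 * (\<Sum>i=1..n. (\<Sum>j\<in>S. c j * fourier j (design n i))\<^sup>2)"
    by (simp add: sum.distrib sum_distrib_left)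
  also have "\<dots> \<le> 4 * real n * ((\<Sum>j\<in>C. (c j)\<^sup>2) + (\<Sum>j\<in>S. (c j)\<^sup>2))"
    using A B by (simp add: algebra_simps)
  also have "\<dots> = 4 * real n * (\<Sum>j\<in>J. (c j)\<^sup>2)" using JCS by (simp add: sum.union_disjoint)
  finally show ?thesis .
qed

section \<open>Coordinates with respect to the design, and bias\<close>

definition coord :: "nat \<Rightarrow> (nat \<Rightarrow> real) \<Rightarrow> nat \<Rightarrow> real" where
  "coord n v j = (\<Sum>i=1..n. fourier j (design n i) * v i) / sqrt (col_sq n j)"

text \<open>For \<open>s \<le> n\<close> this is the squared distance from \<open>v\<close> to the
  span of the first \<open>s\<close> columns. Written as a Bessel defect, it makes differences
  between sizes sums of squared coordinates.\<close>

definition resid :: "nat \<Rightarrow> (nat \<Rightarrow> real) \<Rightarrow> nat \<Rightarrow> real" where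
  "resid n v s = (\<Sum>i=1..n. (v i)\<^sup>2) - (\<Sum>j=1..s. (coord n v j)\<^sup>2)"

lemma square_sum_eq_double_sum: "(\<Sum>j\<in>J. f j)\<^sup>2 = (\<Sum>j\<in>J. \<Sum>k\<in>J. f j * f k)" for f :: "nat \<Rightarrow> real"
  by (simp add: power2_eq_square sum_product)

text \<open>Orthogonality removes the mixed terms of the expanded square. The identity is applied to
  the data (likelihood), to the true values (loss) and to the zero vector (length of a linear form
  in the noise).\<close>

lemma design_pythagoras:
  assumes "s \<le> n"
  shows "(\<Sum>i=1..n. (v i - (\<Sum>j=1..s. \<theta> j * fourier j (design n i)))\<^sup>2)
    = resid n v s + (\<Sum>j=1..s. (sqrt (col_sq n j) * \<theta> j - coord n v j)\<^sup>2)"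
proof -
  define b where "b j = (\<Sum>i=1..n. fourier j (design n i) * v i)" for j
  have cross: "(\<Sum>i=1..n. v i * (\<Sum>j=1..s. \<theta> j * fourier j (design n i))) = (\<Sum>j=1..s. \<theta> j * b j)"
    unfolding sum_distrib_left b_def
    by (rule trans[OF sum.swap]) (simp add: mult_ac)
  have "(\<Sum>i=1..n. (\<Sum>j=1..s. \<theta> j * fourier j (design n i))\<^sup>2)
      = (\<Sum>i=1..n. \<Sum>j=1..s. \<Sum>k=1..s. \<theta> j * \<theta> k * (fourier j (design n i) * fourier k (design n i)))"
    by (simp add: square_sum_eq_double_sum mult_ac)
  also have "\<dots> = (\<Sum>j=1..s. \<Sum>k=1..s. \<theta> j * \<theta> k * (\<Sum>i=1..n. fourier j (design n i) * fourier k (design n i)))"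
    unfolding sum_distrib_left
    by (rule trans[OF sum.swap], rule sum.cong[OF refl], rule sum.swap)
  also have "\<dots> = (\<Sum>j=1..s. \<Sum>k=1..s. if k = j then \<theta> j * \<theta> k * col_sq n j else 0)"
    using fourier_orthogonal[of _ n] assms
    by (intro sum.cong refl) (auto simp: col_sq_def power2_eq_square)
  also have "\<dots> = (\<Sum>j=1..s. (\<theta> j)\<^sup>2 * col_sq n j)" by (simp add: power2_eq_square)
  finally have sq: "(\<Sum>i=1..n. (\<Sum>j=1..s. \<theta> j * fourier j (design n i))\<^sup>2) = (\<Sum>j=1..s. (\<theta> j)\<^sup>2 * col_sq n j)" .
  have "(\<Sum>j=1..s. (sqrt (col_sq n j) * \<theta> j - coord n v j)\<^sup>2)
      = (\<Sum>j=1..s. (\<theta> j)\<^sup>2 * col_sq n j - 2 * (\<theta> j * b j) + (coord n v j)\<^sup>2)"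
  proof (intro sum.cong refl)
    fix j assume "j \<in> {1..s}"
    then have p: "col_sq n j > 0" using col_sq_pos[of j n] assms by simp
    have "sqrt (col_sq n j) * coord n v j = b j" unfolding coord_def b_def using p by simp
    then show "(sqrt (col_sq n j) * \<theta> j - coord n v j)\<^sup>2 = (\<theta> j)\<^sup>2 * col_sq n j - 2 * (\<theta> j * b j) + (coord n v j)\<^sup>2"
      using p by (simp add: power2_diff power_mult_distrib)
  qed
  moreover have "(\<Sum>i=1..n. (v i - (\<Sum>j=1..s. \<theta> j * fourier j (design n i)))\<^sup>2)
     = (\<Sum>i=1..n. (v i)\<^sup>2) - 2 * (\<Sum>i=1..n. v i * (\<Sum>j=1..s. \<theta> j * fourier j (design n i)))
       + (\<Sum>i=1..n. (\<Sum>j=1..s. \<theta> j * fourier j (design n i))\<^sup>2)"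
    by (simp add: power2_diff sum.distrib sum_subtractf sum_distrib_left mult_ac)
  ultimately show ?thesis unfolding cross sq resid_def
    by (simp add: sum.distrib sum_subtractf sum_distrib_left)
qed

lemma resid_le:
  assumes "s \<le> n"
  shows "resid n v s \<le> (\<Sum>i=1..n. (v i - (\<Sum>j=1..s. \<theta> j * fourier j (design n i)))\<^sup>2)"
  unfolding design_pythagoras[OF assms] by (simp add: sum_nonneg)

lemma resid_nonneg:
  assumes "s \<le> n"
  shows "resid n v s \<ge> 0"
proof -
  have "(\<Sum>j=1..s. (sqrt (col_sq n j) * (coord n v j / sqrt (col_sq n j)) - coord n v j)\<^sup>2) = 0"
    using col_sq_pos[of _ n] assms by (intro sum.neutral ballI) fastforce
  then show ?thesis
    using design_pythagoras[OF assms, of v "\<lambda>j. coord n v j / sqrt (col_sq n j)"]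
    by (smt (verit) sum_nonneg zero_le_power2)
qed

lemma resid_diff:
  assumes "s \<le> t"
  shows "resid n v s - resid n v t = (\<Sum>j=Suc s..t. (coord n v j)\<^sup>2)"
proof -
  have "{1..t} = {1..s} \<union> {Suc s..t}" using assms by auto
  then show ?thesis unfolding resid_def by (simp add: sum.union_disjoint)
qed

section \<open>Bias of Sobolev sequences\<close>

lemma abs_fourier_le: "\<bar>fourier j t\<bar> \<le> sqrt 2"
proof -
  have "\<bar>sqrt 2 * x\<bar> \<le> sqrt 2" if "\<bar>x\<bar> \<le> 1" for x :: real
    using that by (simp add: abs_mult mult_left_le)
  moreover have "1 \<le> sqrt 2" by simp
  ultimately show ?thesis unfolding fourier_def by auto
qed

lemma summable_powr_Suc:
  assumes "\<beta> > 1 / 2"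
  shows "summable (\<lambda>j. real (Suc j) powr (- 2 * \<beta>))"
  using assms summable_Suc_iff[of "\<lambda>j. real j powr (- 2 * \<beta>)"] summable_real_powr_iff[of "- 2 * \<beta>"] by simp

text \<open>Splitting off the weight \<open>k powr \<beta>\<close>, the arithmetic-geometric mean
  inequality bounds \<open>2 * \<bar>\<theta> k\<bar>\<close> by a term of the Sobolev norm plus
  \<open>k powr (- 2 * \<beta>)\<close>; both are summable.\<close>

lemma summable_fseries:
  assumes "\<beta> > 1 / 2" "\<theta> \<in> sobolev \<beta>"
  shows "summable (\<lambda>j. \<theta> (Suc j) * fourier (Suc j) t)"
proof (rule summable_comparison_test')
  let ?q = "\<lambda>j. (\<theta> (Suc j))\<^sup>2 * real (Suc j) powr (2 * \<beta>)"
  show "summable (\<lambda>j. sqrt 2 * (?q j + real (Suc j) powr (- 2 * \<beta>)))"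
    using assms(2) summable_powr_Suc[OF assms(1)] unfolding sobolev_def
    by (intro summable_mult summable_add) simp_all
  fix j :: nat assume "0 \<le> j"
  define k where "k = real (Suc j)"
  have k: "k > 0" by (simp add: k_def)
  have "2 * (\<bar>\<theta> (Suc j)\<bar> * k powr \<beta>) * (k powr (- \<beta>)) \<le> (\<bar>\<theta> (Suc j)\<bar> * k powr \<beta>)\<^sup>2 + (k powr (- \<beta>))\<^sup>2"
    by (rule sum_squares_bound)
  moreover have "k powr \<beta> * k powr (- \<beta>) = 1" using k by (simp add: powr_add[symmetric])
  moreover have "(k powr \<beta>)\<^sup>2 = k powr (2 * \<beta>)" "(k powr (- \<beta>))\<^sup>2 = k powr (- 2 * \<beta>)"
    using k by (simp_all add: power2_eq_square powr_add[symmetric])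
  ultimately have "2 * \<bar>\<theta> (Suc j)\<bar> \<le> ?q j + k powr (- 2 * \<beta>)"
    by (simp add: power_mult_distrib mult.assoc k_def)
  then have th: "\<bar>\<theta> (Suc j)\<bar> \<le> ?q j + k powr (- 2 * \<beta>)" by linarith
  have "norm (\<theta> (Suc j) * fourier (Suc j) t) \<le> \<bar>\<theta> (Suc j)\<bar> * sqrt 2"
    using abs_fourier_le by (simp add: abs_mult mult_left_mono)
  also have "\<dots> \<le> (?q j + k powr (- 2 * \<beta>)) * sqrt 2" using th by (intro mult_right_mono) auto
  finally show "norm (\<theta> (Suc j) * fourier (Suc j) t) \<le> sqrt 2 * (?q j + real (Suc j) powr (- 2 * \<beta>))"
    by (simp add: k_def mult.commute)
qed

lemma weighted_Cauchy_Schwarz_sum: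
  fixes a l :: "nat \<Rightarrow> real"
  assumes "\<And>m. m \<in> I \<Longrightarrow> l m > 0"
  shows "(\<Sum>m\<in>I. a m)\<^sup>2 \<le> (\<Sum>m\<in>I. l m) * (\<Sum>m\<in>I. (a m)\<^sup>2 / l m)"
proof -
  have "(\<Sum>m\<in>I. a m)\<^sup>2 = (\<Sum>m\<in>I. sqrt (l m) * (a m / sqrt (l m)))\<^sup>2"
    using assms by (intro arg_cong[where f="\<lambda>x. x\<^sup>2"] sum.cong refl) (auto, metis less_irrefl)
  also have "\<dots> \<le> (\<Sum>m\<in>I. (sqrt (l m))\<^sup>2) * (\<Sum>m\<in>I. (a m / sqrt (l m))\<^sup>2)"
    by (rule Cauchy_Schwarz_ineq_sum)
  also have "\<dots> = (\<Sum>m\<in>I. l m) * (\<Sum>m\<in>I. (a m)\<^sup>2 / l m)"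
    using assms by (intro arg_cong2[where f="(*)"] sum.cong refl) (auto simp: power_divide less_imp_le)
  finally show ?thesis .
qed

definition sobolev_tail :: "real \<Rightarrow> (nat \<Rightarrow> real) \<Rightarrow> nat \<Rightarrow> real" where
  "sobolev_tail \<beta> \<theta> s = (\<Sum>j. (\<theta> (Suc (j + s)))\<^sup>2 * real (Suc (j + s)) powr (2 * \<beta>))"

lemma sobolev_tail_tendsto:
  assumes "\<theta> \<in> sobolev \<beta>"
  shows "sobolev_tail \<beta> \<theta> \<longlonglongrightarrow> 0"
proof -
  let ?q = "\<lambda>j. (\<theta> (Suc j))\<^sup>2 * real (Suc j) powr (2 * \<beta>)"
  have s: "summable ?q" using assms by (simp add: sobolev_def)
  have "(\<lambda>k. suminf ?q - sum ?q {..<k}) \<longlonglongrightarrow> suminf ?q - suminf ?q"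
    by (intro tendsto_diff tendsto_const summable_LIMSEQ[OF s])
  moreover have "suminf ?q - sum ?q {..<k} = sobolev_tail \<beta> \<theta> k" for k
    unfolding sobolev_tail_def using suminf_minus_initial_segment[OF s, of k] by simp
  ultimately show ?thesis by simp
qed

text \<open>
  The tail of the series is cut into blocks of length \<open>n\<close>. The functions of a block are essentially
  orthogonal on the design, however strongly different blocks alias, and the weights
  \<open>(s + m * n) powr (- 2 * \<beta>)\<close> in the Cauchy-Schwarz inequality over the blocks are summable
  exactly because \<open>\<beta> > 1 / 2\<close>.
\<close>

lemma bias_le:
  assumes \<beta>: "\<beta> > 1 / 2" and \<theta>: "\<theta> \<in> sobolev \<beta>" and s: "1 \<le> s" "s \<le> n"
  shows "resid n (\<lambda>i. fseries \<theta> (design n i)) s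
    \<le> 4 * (\<Sum>m. real (Suc m) powr (- 2 * \<beta>)) * real n * real s powr (- 2 * \<beta>) * sobolev_tail \<beta> \<theta> s"
proof -
  define Z where "Z = (\<Sum>m. real (Suc m) powr (- 2 * \<beta>))"
  define q where "q j = (\<theta> (Suc j))\<^sup>2 * real (Suc j) powr (2 * \<beta>)" for j
  define h where "h i j = \<theta> (Suc j) * fourier (Suc j) (design n i)" for i j
  define v where "v m i = (\<Sum>j=m*n..<m*n+n. h i (j + s))" for m i
  \<comment> \<open>Block \<open>m\<close> contains only indices above \<open>s + m * n\<close>, so
    \<open>l m\<close> dominates \<open>real j powr (- 2 * \<beta>)\<close> for all its indices
    \<open>j\<close>.\<close>
  define l where "l m = real (s + m * n) powr (- 2 * \<beta>)" for m
  have n: "n > 0" using s by simp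
  have sq: "summable q" using \<theta> by (simp add: sobolev_def q_def[abs_def])
  have qn: "q j \<ge> 0" for j by (simp add: q_def)
  have sh: "summable (h i)" for i unfolding h_def by (rule summable_fseries[OF \<beta> \<theta>])
  have lpos: "l m > 0" for m
  proof -
    have "s + m * n \<noteq> 0" using s by simp
    then have "real (s + m * n) \<noteq> 0" by (metis of_nat_eq_0_iff)
    then show ?thesis unfolding l_def powr_gt_zero .
  qed
  have lsum: "(\<Sum>m<N. l m) \<le> real s powr (- 2 * \<beta>) * Z" for N
  proof -
    have "l m \<le> real s powr (- 2 * \<beta>) * real (Suc m) powr (- 2 * \<beta>)" for m
    proof -
      \<comment> \<open>Here \<open>s \<le> n\<close> enters; it separates the factor
        \<open>s powr (- 2 * \<beta>)\<close> from a series depending on \<beta> alone.\<close>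
      have "real s * real (Suc m) \<le> real (s + m * n)"
        using mult_left_mono[of "real s" "real n" "real m"] s by (simp add: algebra_simps)
      then have "real (s + m * n) powr (- 2 * \<beta>) \<le> (real s * real (Suc m)) powr (- 2 * \<beta>)"
        using s \<beta> by (intro powr_mono2') auto
      then show ?thesis by (simp add: l_def powr_mult)
    qed
    then have "(\<Sum>m<N. l m) \<le> (\<Sum>m<N. real s powr (- 2 * \<beta>) * real (Suc m) powr (- 2 * \<beta>))"
      by (intro sum_mono)
    also have "\<dots> \<le> real s powr (- 2 * \<beta>) * Z"
      unfolding sum_distrib_left[symmetric] Z_def
      by (intro mult_left_mono sum_le_suminf summable_powr_Suc \<beta>) auto
    finally show ?thesis .
  qed
  have block: "(\<Sum>i=1..n. (v m i)\<^sup>2) / l m \<le> 4 * real n * (\<Sum>j=m*n..<m*n+n. q (j + s))" for m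
  proof -
    have re: "(\<Sum>j=m*n..<m*n+n. F (Suc (j + s))) = (\<Sum>j\<in>{Suc (s+m*n)..(s+m*n)+n}. F j)" for F :: "nat \<Rightarrow> real"
      by (rule sum.reindex_bij_witness[of _ "\<lambda>j. j - Suc s" "\<lambda>j. Suc (j + s)"]) auto
    have "(\<Sum>i=1..n. (v m i)\<^sup>2) \<le> 4 * real n * (\<Sum>j\<in>{Suc (s+m*n)..(s+m*n)+n}. (\<theta> j)\<^sup>2)"
      using fourier_block_le[OF n order_refl, where m = "s+m*n" and c = \<theta>]
      unfolding v_def h_def re[of "\<lambda>j. \<theta> j * fourier j (design n _)"] by simp
    also have "\<dots> = 4 * real n * (\<Sum>j=m*n..<m*n+n. (\<theta> (Suc (j + s)))\<^sup>2)"
      using re[of "\<lambda>j. (\<theta> j)\<^sup>2"] by simp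
    also have "\<dots> \<le> 4 * real n * (\<Sum>j=m*n..<m*n+n. l m * q (j + s))"
    proof (intro mult_left_mono sum_mono)
      fix j assume "j \<in> {m*n..<m*n+n}"
      then have "s + m * n \<le> Suc (j + s)" by auto
      then have j: "real (s + m * n) \<le> real (Suc (j + s))" by (rule of_nat_mono)
      have "1 = real (s + m * n) powr (- 2 * \<beta>) * real (s + m * n) powr (2 * \<beta>)"
        using lpos[of m] unfolding l_def powr_gt_zero powr_add[symmetric] by (simp del: of_nat_add of_nat_mult)
      also have "\<dots> \<le> l m * real (Suc (j + s)) powr (2 * \<beta>)"
        unfolding l_def using j \<beta> by (intro mult_left_mono powr_mono2 of_nat_0_le_iff powr_ge_zero) auto
      finally have "(\<theta> (Suc (j + s)))\<^sup>2 * 1 \<le> (\<theta> (Suc (j + s)))\<^sup>2 * (l m * real (Suc (j + s)) powr (2 * \<beta>))"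
        by (intro mult_left_mono) auto
      then show "(\<theta> (Suc (j + s)))\<^sup>2 \<le> l m * q (j + s)" by (simp add: q_def mult_ac)
    qed auto
    also have "\<dots> = l m * (4 * real n * (\<Sum>j=m*n..<m*n+n. q (j + s)))"
      by (simp add: sum_distrib_left[symmetric])
    finally show ?thesis using lpos[of m] by (simp add: field_simps)
  qed
  have fin: "(\<Sum>i=1..n. (\<Sum>j<N*n. h i (j + s))\<^sup>2) \<le> 4 * Z * real n * real s powr (- 2 * \<beta>) * sobolev_tail \<beta> \<theta> s" for N
  proof -
    have "(\<Sum>i=1..n. (\<Sum>j<N*n. h i (j + s))\<^sup>2) = (\<Sum>i=1..n. (\<Sum>m<N. v m i)\<^sup>2)"
      unfolding v_def sum.nat_group ..
    also have "\<dots> \<le> (\<Sum>i=1..n. (\<Sum>m<N. l m) * (\<Sum>m<N. (v m i)\<^sup>2 / l m))"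
      by (intro sum_mono weighted_Cauchy_Schwarz_sum lpos)
    also have "\<dots> = (\<Sum>m<N. l m) * (\<Sum>m<N. (\<Sum>i=1..n. (v m i)\<^sup>2) / l m)"
      unfolding sum_distrib_left[symmetric] sum_divide_distrib by (simp add: sum.swap[of _ _ "{..<N}"])
    also have "\<dots> \<le> (\<Sum>m<N. l m) * (\<Sum>m<N. 4 * real n * (\<Sum>j=m*n..<m*n+n. q (j + s)))"
      using lpos by (intro mult_left_mono sum_mono block sum_nonneg) (auto intro: less_imp_le)
    also have "\<dots> = (\<Sum>m<N. l m) * (4 * real n * (\<Sum>j<N*n. q (j + s)))"
      unfolding sum_distrib_left[symmetric] sum.nat_group ..
    also have "\<dots> \<le> (\<Sum>m<N. l m) * (4 * real n * sobolev_tail \<beta> \<theta> s)"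
    proof -
      have "(\<Sum>j<N*n. q (j + s)) \<le> sobolev_tail \<beta> \<theta> s"
        unfolding sobolev_tail_def q_def[symmetric]
        by (rule sum_le_suminf) (auto simp: qn sq)
      then show ?thesis using lpos
        by (intro mult_left_mono sum_nonneg mult_nonneg_nonneg) (auto intro: less_imp_le)
    qed
    also have "\<dots> \<le> (real s powr (- 2 * \<beta>) * Z) * (4 * real n * sobolev_tail \<beta> \<theta> s)"
    proof (intro mult_right_mono lsum mult_nonneg_nonneg)
      show "0 \<le> sobolev_tail \<beta> \<theta> s"
        unfolding sobolev_tail_def q_def[symmetric]
        by (rule suminf_nonneg) (auto simp: qn sq)
    qed auto
    finally show ?thesis by (simp add: mult_ac)
  qed
  have split: "fseries \<theta> (design n i) - (\<Sum>j=1..s. \<theta> j * fourier j (design n i)) = (\<Sum>j. h i (j + s))" for i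
  proof -
    have "(\<Sum>j=1..s. \<theta> j * fourier j (design n i)) = (\<Sum>j<s. h i j)"
      unfolding h_def by (simp add: sum.atLeast1_atMost_eq)
    then show ?thesis
      using suminf_minus_initial_segment[OF sh, of i s] by (simp add: fseries_def h_def)
  qed
  \<comment> \<open>The truncation of \<theta> at \<open>s\<close> competes with the projection, so
    the squared tail of the series bounds the residual.\<close>
  have "resid n (\<lambda>i. fseries \<theta> (design n i)) s \<le> (\<Sum>i=1..n. (\<Sum>j. h i (j + s))\<^sup>2)"
    using resid_le[OF s(2), of "\<lambda>i. fseries \<theta> (design n i)" \<theta>] unfolding split .
  also have "\<dots> \<le> 4 * Z * real n * real s powr (- 2 * \<beta>) * sobolev_tail \<beta> \<theta> s"
  proof (rule LIMSEQ_le_const2)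
    \<comment> \<open>Partial sums consist of whole blocks, so the limit is taken along multiples of
      \<open>n\<close>.\<close>
    have fl: "filterlim (\<lambda>N. N * n) at_top sequentially"
      using n by (intro mult_nat_right_at_top)
    have "(\<lambda>N. \<Sum>j<N*n. h i (j + s)) \<longlonglongrightarrow> (\<Sum>j. h i (j + s))" for i
      by (rule filterlim_compose[OF summable_LIMSEQ[OF summable_ignore_initial_segment[OF sh, of i s]] fl])
    then show "(\<lambda>N. \<Sum>i=1..n. (\<Sum>j<N*n. h i (j + s))\<^sup>2) \<longlonglongrightarrow> (\<Sum>i=1..n. (\<Sum>j. h i (j + s))\<^sup>2)"
      by (intro tendsto_intros)
    show "\<exists>N0. \<forall>N\<ge>N0. (\<Sum>i=1..n. (\<Sum>j<N*n. h i (j + s))\<^sup>2) \<le> 4 * Z * real n * real s powr (- 2 * \<beta>) * sobolev_tail \<beta> \<theta> s"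
      using fin by blast
  qed
  finally show ?thesis unfolding Z_def .
qed

text \<open>The exponent solves \<open>n * r powr (- 2 * \<beta>) = r\<close>, the balance of
  squared bias and dimension. The cost \<open>\<delta> powr (- 2 * \<beta>)\<close> of a small
  \<delta> is a constant, so the vanishing tail eventually beats it.\<close>

lemma bias_small:
  assumes \<beta>: "\<beta> > 1 / 2" and \<theta>: "\<theta> \<in> sobolev \<beta>" and \<delta>: "\<delta> > 0"
  shows "\<forall>\<^sub>F n in sequentially. resid n (\<lambda>i. fseries \<theta> (design n i)) (nat \<lceil>\<delta> * real n powr (1 / (2 * \<beta> + 1))\<rceil>)
    \<le> \<delta> * real n powr (1 / (2 * \<beta> + 1))"
proof -
  define r where "r n = real n powr (1 / (2 * \<beta> + 1))" for n
  define S where "S n = nat \<lceil>\<delta> * r n\<rceil>" for n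
  define Z where "Z = (\<Sum>m. real (Suc m) powr (- 2 * \<beta>))"
  have rtop: "filterlim r at_top sequentially"
    unfolding r_def using \<beta> by real_asymp
  have "filterlim (\<lambda>n. \<delta> * r n) at_top sequentially"
    by (rule filterlim_tendsto_pos_mult_at_top[OF tendsto_const \<delta> rtop])
  then have "filterlim (\<lambda>n. real (S n)) at_top sequentially"
    by (rule filterlim_at_top_mono) (simp add: S_def, intro always_eventually allI, linarith)
  then have Stop: "filterlim S at_top sequentially"
    by (simp add: filterlim_sequentially_iff_filterlim_real)
  have "(\<lambda>n. 4 * Z * \<delta> powr (- 2 * \<beta>) * sobolev_tail \<beta> \<theta> (S n)) \<longlonglongrightarrow> 4 * Z * \<delta> powr (- 2 * \<beta>) * 0"
    by (intro tendsto_intros filterlim_compose[OF sobolev_tail_tendsto[OF \<theta>] Stop])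
  then have ev1: "\<forall>\<^sub>F n in sequentially. 4 * Z * \<delta> powr (- 2 * \<beta>) * sobolev_tail \<beta> \<theta> (S n) < \<delta>"
    using \<delta> by (intro order_tendstoD(2)[of _ 0]) auto
  \<comment> \<open>The summand 1 covers the ceiling, giving \<open>S n \<le> n\<close>.\<close>
  have ev2: "\<forall>\<^sub>F n in sequentially. \<delta> * r n + 1 \<le> real n"
    unfolding r_def using \<beta> \<delta> by real_asymp
  show ?thesis unfolding r_def[symmetric] S_def[symmetric]
    using ev1 ev2 eventually_gt_at_top[of 0]
  proof eventually_elim
    case (elim n)
    have r: "r n > 0" using elim by (simp add: r_def)
    have S1: "1 \<le> S n" using r \<delta> by (simp add: S_def Suc_le_eq)
    have Sr: "\<delta> * r n \<le> real (S n)" unfolding S_def by linarith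
    have Sn: "S n \<le> n" using elim(2) r \<delta> unfolding S_def by linarith
    have Z: "Z \<ge> 0" unfolding Z_def by (rule suminf_nonneg[OF summable_powr_Suc[OF \<beta>]]) simp
    have T: "sobolev_tail \<beta> \<theta> (S n) \<ge> 0"
      unfolding sobolev_tail_def using \<theta>
      by (intro suminf_nonneg summable_ignore_initial_segment[where f="\<lambda>j. (\<theta> (Suc j))\<^sup>2 * real (Suc j) powr (2 * \<beta>)"]) (auto simp: sobolev_def)
    have nr: "real n * r n powr (- 2 * \<beta>) = r n"
    proof -
      have "real n = r n powr (2 * \<beta> + 1)" unfolding r_def using \<beta> elim by (simp add: powr_powr)
      then have "real n * r n powr (- 2 * \<beta>) = r n powr (2 * \<beta> + 1) * r n powr (- 2 * \<beta>)" by simp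
      also have "\<dots> = r n" using r by (simp add: powr_add[symmetric])
      finally show ?thesis .
    qed
    have "resid n (\<lambda>i. fseries \<theta> (design n i)) (S n) \<le> 4 * Z * real n * real (S n) powr (- 2 * \<beta>) * sobolev_tail \<beta> \<theta> (S n)"
      unfolding Z_def by (rule bias_le[OF \<beta> \<theta> S1 Sn])
    also have "\<dots> \<le> 4 * Z * real n * (\<delta> * r n) powr (- 2 * \<beta>) * sobolev_tail \<beta> \<theta> (S n)"
      using Z T Sr r \<delta> \<beta> by (intro mult_right_mono mult_left_mono powr_mono2') auto
    also have "\<dots> = (4 * Z * \<delta> powr (- 2 * \<beta>) * sobolev_tail \<beta> \<theta> (S n)) * (real n * r n powr (- 2 * \<beta>))"
      using \<delta> r by (simp add: powr_mult)
    also have "\<dots> \<le> \<delta> * r n" unfolding nr using elim(1) r by (intro mult_right_mono) auto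
    finally show ?case .
  qed
qed

section \<open>The conditional priors and their mixtures\<close>

definition diagm :: "nat \<Rightarrow> (nat \<Rightarrow> real) \<Rightarrow> real mat" where
  "diagm s f = Matrix.mat s s (\<lambda>(i, j). if i = j then f i else 0)"

lemma diagm_carrier: "diagm s f \<in> carrier_mat s s"
  by (simp add: diagm_def)

lemma diagm_mult_inverse:
  assumes "\<And>i. i < s \<Longrightarrow> f i \<noteq> 0"
  shows "diagm s f * diagm s (\<lambda>i. 1 / f i) = 1\<^sub>m s"
proof (rule eq_matI)
  fix i j assume ij: "i < dim_row (1\<^sub>m s)" "j < dim_col (1\<^sub>m s)"
  have "(diagm s f * diagm s (\<lambda>i. 1 / f i)) $$ (i, j)
      = (\<Sum>k = 0..<s. (if i = k then f i else 0) * (if k = j then 1 / f k else 0))"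
    using ij by (simp add: diagm_def scalar_prod_def)
  also have "\<dots> = (\<Sum>k = 0..<s. if k = i then (if i = j then 1 else 0) else 0)"
    using assms by (intro sum.cong) auto
  finally show "(diagm s f * diagm s (\<lambda>i. 1 / f i)) $$ (i, j) = 1\<^sub>m s $$ (i, j)" using ij by simp
qed (auto simp: diagm_def)

text \<open>\<open>mat_inv\<close> applies \<open>the\<close> to a partial inverse: the explicit
  inverse shows that the matrix is a unit, which excludes \<open>None\<close>, and uniqueness of
  inverses identifies the value.\<close>

lemma mat_inv_diagm:
  assumes f: "\<And>i. i < s \<Longrightarrow> f i \<noteq> 0"
  shows "mat_inv (diagm s f) = diagm s (\<lambda>i. 1 / f i)"
proof -
  let ?A = "diagm s f" and ?C = "diagm s (\<lambda>i. 1 / f i)"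
  have AC: "?A * ?C = 1\<^sub>m s" using f by (rule diagm_mult_inverse)
  have CA: "?C * ?A = 1\<^sub>m s" using diagm_mult_inverse[of s "\<lambda>i. 1 / f i"] f by simp
  have U: "?A \<in> Units (ring_mat TYPE(real) s ())"
    unfolding Units_def ring_mat_def using AC CA diagm_carrier[of s] by auto
  obtain B where B: "mat_inverse ?A = Some B" using mat_inverse(1)[OF diagm_carrier[of s f], of "()"] U by fastforce
  then have BA: "B * ?A = 1\<^sub>m s" "B \<in> carrier_mat s s"
    using mat_inverse(2)[OF diagm_carrier] by auto
  have "B = B * (?A * ?C)" using AC BA by simp
  also have "\<dots> = (B * ?A) * ?C" using assoc_mult_mat[OF BA(2) diagm_carrier diagm_carrier] by simp
  also have "\<dots> = ?C" unfolding BA(1) by (rule left_mult_one_mat[OF diagm_carrier])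
  finally show ?thesis by (simp add: mat_inv_def B)
qed

lemma smult_diagm: "c \<cdot>\<^sub>m diagm s f = diagm s (\<lambda>i. c * f i)"
  by (rule eq_matI) (auto simp: diagm_def)

lemma det_diagm: "Determinant.det (diagm s f) = (\<Prod>i<s. f i)"
proof -
  have "Determinant.det (diagm s f) = prod_list (diag_mat (diagm s f))"
    by (rule det_upper_triangular[of _ s]) (auto simp: diagm_def upper_triangular_def)
  also have "\<dots> = (\<Prod>i<s. f i)"
    unfolding prod_list_diag_prod by (simp add: diagm_def lessThan_atLeast0)
  finally show ?thesis .
qed

lemma diagm_mult_vec: "dim_vec v = s \<Longrightarrow> diagm s f *\<^sub>v v = Matrix.vec s (\<lambda>i. f i * vec_index v i)"
  by (rule eq_vecI) (auto simp: diagm_def scalar_prod_def if_distrib[where f="\<lambda>x. x * _"] cong: if_cong)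

lemma gram_mat_eq:
  assumes "s \<le> n"
  shows "gram_mat n s = diagm s (\<lambda>j. col_sq n (Suc j))"
proof (rule eq_matI)
  fix i j assume ij: "i < dim_row (diagm s (\<lambda>j. col_sq n (Suc j)))" "j < dim_col (diagm s (\<lambda>j. col_sq n (Suc j)))"
  then have ij': "i < s" "j < s" by (auto simp: diagm_def)
  have "gram_mat n s $$ (i, j) = (\<Sum>k=0..<n. fourier (Suc i) (design n (Suc k)) * fourier (Suc j) (design n (Suc k)))"
    using ij' by (simp add: gram_mat_def design_mat_def scalar_prod_def)
  also have "\<dots> = (\<Sum>k=1..n. fourier (Suc i) (design n k) * fourier (Suc j) (design n k))"
    by (simp add: sum.atLeast1_atMost_eq lessThan_atLeast0)
  also have "\<dots> = (if i = j then col_sq n (Suc i) else 0)"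
    using fourier_orthogonal[of "Suc i" n "Suc j"] ij' assms by (auto simp: col_sq_def power2_eq_square)
  finally show "gram_mat n s $$ (i, j) = diagm s (\<lambda>j. col_sq n (Suc j)) $$ (i, j)"
    using ij' by (simp add: diagm_def)
qed (auto simp: gram_mat_def design_mat_def diagm_def)

text \<open>By orthogonality the least-squares coefficients do not change with the size, so
  \<open>s\<close> is not an argument.\<close>

definition lsq :: "nat \<Rightarrow> (nat \<Rightarrow> real) \<Rightarrow> nat \<Rightarrow> real" where
  "lsq n Y j = coord n Y j / sqrt (col_sq n j)"

lemma lse_eq:
  assumes "s \<le> n"
  shows "lse n s Y = Matrix.vec s (\<lambda>j. lsq n Y (Suc j))"
proof -
  have d: "dim_vec (transpose_mat (design_mat n s) *\<^sub>v Matrix.vec n (\<lambda>i. Y (Suc i))) = s"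
    by (simp add: design_mat_def)
  have c: "col_sq n (Suc j) > 0" if "j < s" for j using col_sq_pos[of "Suc j" n] that assms by simp
  show ?thesis
    unfolding lse_def gram_mat_eq[OF assms]
  proof (subst mat_inv_diagm, goal_cases)
    case (1 i)
    then show ?case using c by fastforce
  next
    case 2
    show ?case unfolding diagm_mult_vec[OF d]
    proof (rule eq_vecI)
      fix j assume "j < dim_vec (Matrix.vec s (\<lambda>j. lsq n Y (Suc j)))"
      then have j: "j < s" by simp
      have "vec_index (transpose_mat (design_mat n s) *\<^sub>v Matrix.vec n (\<lambda>i. Y (Suc i))) j
          = (\<Sum>i=0..<n. fourier (Suc j) (design n (Suc i)) * Y (Suc i))"
        using j by (simp add: design_mat_def scalar_prod_def)
      also have "\<dots> = (\<Sum>i=1..n. fourier (Suc j) (design n i) * Y i)"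
        by (simp add: sum.atLeast1_atMost_eq lessThan_atLeast0)
      finally show "vec_index (Matrix.vec s (\<lambda>i. 1 / col_sq n (Suc i) *
          vec_index (transpose_mat (design_mat n s) *\<^sub>v Matrix.vec n (\<lambda>i. Y (Suc i))) i)) j
        = vec_index (Matrix.vec s (\<lambda>j. lsq n Y (Suc j))) j"
        using j c[OF j] by (simp add: lsq_def coord_def)
    qed simp
  qed
qed

lemma sqrt_prod: "sqrt (\<Prod>i\<in>A. f i) = (\<Prod>i\<in>A. sqrt (f i))"
  by (induction A rule: infinite_finite_induct) (auto simp: real_sqrt_mult)

lemma mvn_density_eq:
  assumes "s \<le> n" "\<gamma> > 0"
  shows "mvn_density (lse n s Y) ((1 / \<gamma>) \<cdot>\<^sub>m mat_inv (gram_mat n s)) (Matrix.vec s (\<lambda>k. x (Suc k)))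
    = (\<Prod>j=1..s. normal_density (lsq n Y j) (1 / sqrt (\<gamma> * col_sq n j)) (x j))"
proof -
  define d where "d j = col_sq n (Suc j)" for j
  have d: "d j > 0" if "j < s" for j using col_sq_pos[of "Suc j" n] that assms by (simp add: d_def)
  have d0: "d j \<noteq> 0" if "j < s" for j using d[OF that] by simp
  have C: "(1 / \<gamma>) \<cdot>\<^sub>m mat_inv (gram_mat n s) = diagm s (\<lambda>j. 1 / (\<gamma> * d j))"
    unfolding gram_mat_eq[OF assms(1)] d_def[symmetric] using d0
    by (subst mat_inv_diagm) (auto simp: smult_diagm)
  have Ci: "mat_inv (diagm s (\<lambda>j. 1 / (\<gamma> * d j))) = diagm s (\<lambda>j. \<gamma> * d j)"
    using d0 assms(2) by (subst mat_inv_diagm) auto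
  define e where "e j = x (Suc j) - lsq n Y (Suc j)" for j
  have xm: "Matrix.vec s (\<lambda>k. x (Suc k)) - Matrix.vec s (\<lambda>j. lsq n Y (Suc j)) = Matrix.vec s e"
    by (rule eq_vecI) (auto simp: e_def)
  have "mvn_density (lse n s Y) ((1 / \<gamma>) \<cdot>\<^sub>m mat_inv (gram_mat n s)) (Matrix.vec s (\<lambda>k. x (Suc k)))
      = exp (- (\<Sum>j<s. \<gamma> * d j * (e j)\<^sup>2) / 2) / sqrt ((2 * pi) ^ s * (\<Prod>j<s. 1 / (\<gamma> * d j)))"
    unfolding mvn_density_def C Ci lse_eq[OF assms(1)] xm det_diagm
    by (subst diagm_mult_vec) (auto simp: scalar_prod_def lessThan_atLeast0 power2_eq_square mult_ac)
  also have "\<dots> = (\<Prod>j<s. exp (- (\<gamma> * d j * (e j)\<^sup>2) / 2) / sqrt (2 * pi * (1 / (\<gamma> * d j))))"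
  proof -
    have "(2 * pi) ^ s * (\<Prod>j<s. 1 / (\<gamma> * d j)) = (\<Prod>j<s. 2 * pi * (1 / (\<gamma> * d j)))"
      unfolding prod.distrib by simp
    then show ?thesis
      unfolding prod_dividef sqrt_prod[symmetric] exp_sum[OF finite_lessThan, symmetric]
      by (simp add: sum_negf sum_divide_distrib)
  qed
  also have "\<dots> = (\<Prod>j<s. normal_density (lsq n Y (Suc j)) (1 / sqrt (\<gamma> * col_sq n (Suc j))) (x (Suc j)))"
  proof (intro prod.cong refl)
    fix j assume "j \<in> {..<s}"
    then have g: "\<gamma> * d j > 0" using d assms(2) by simp
    have sq: "(1 / sqrt (\<gamma> * d j))\<^sup>2 = 1 / (\<gamma> * d j)" using g by (simp add: power_divide)
    show "exp (- (\<gamma> * d j * (e j)\<^sup>2) / 2) / sqrt (2 * pi * (1 / (\<gamma> * d j)))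
        = normal_density (lsq n Y (Suc j)) (1 / sqrt (\<gamma> * col_sq n (Suc j))) (x (Suc j))"
      unfolding normal_density_def d_def[symmetric] sq e_def[symmetric] by simp
  qed
  also have "\<dots> = (\<Prod>j=1..s. normal_density (lsq n Y j) (1 / sqrt (\<gamma> * col_sq n j)) (x j))"
    by (simp add: prod.atLeast1_atMost_eq)
  finally show ?thesis .
qed

text \<open>Points of the product space over \<open>{1..s}\<close> are \<open>undefined\<close>
  elsewhere; padding turns them into coefficient sequences.\<close>

definition pad :: "nat \<Rightarrow> (nat \<Rightarrow> real) \<Rightarrow> nat \<Rightarrow> real" where
  "pad s x = (\<lambda>j. if j \<in> {1..s} then x j else 0)"

definition cond_density :: "real \<Rightarrow> nat \<Rightarrow> (nat \<Rightarrow> real) \<Rightarrow> nat \<Rightarrow> (nat \<Rightarrow> real) \<Rightarrow> real" where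
  "cond_density \<gamma> n Y s x = (\<Prod>j=1..s. normal_density (lsq n Y j) (1 / sqrt (\<gamma> * col_sq n j)) (x j))"

lemma zero_pad_vec: "zero_pad (Matrix.vec s (\<lambda>k. x (Suc k))) = pad s x"
proof
  fix j
  have "j - 1 < s" if "j \<in> {1..s}" using that by auto
  then show "zero_pad (Matrix.vec s (\<lambda>k. x (Suc k))) j = pad s x j"
    by (cases "j \<in> {1..s}") (auto simp: zero_pad_def pad_def)
qed

lemma measurable_pad: "pad s \<in> measurable (\<Pi>\<^sub>M j\<in>{1..s}. lborel) seq_space"
  unfolding pad_def
proof (rule measurable_abs_UNIV)
  fix j :: nat
  show "(\<lambda>x. if j \<in> {1..s} then x j else 0) \<in> borel_measurable (\<Pi>\<^sub>M j\<in>{1..s}. lborel)"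
  proof (cases "j \<in> {1..s}")
    case True
    have "(\<lambda>x. x j) \<in> measurable (\<Pi>\<^sub>M j\<in>{1..s}. lborel) (lborel :: real measure)"
      using True by (rule measurable_component_singleton)
    then show ?thesis using True by simp
  next
    case False
    show ?thesis unfolding if_not_P[OF False] by simp
  qed
qed

lemma measurable_cond_density:
  "(\<lambda>x. cond_density \<gamma> n Y s x) \<in> borel_measurable (\<Pi>\<^sub>M j\<in>{1..s}. lborel)"
  unfolding cond_density_def
proof (rule borel_measurable_prod)
  fix j assume "j \<in> {1..s}"
  then have "(\<lambda>x. x j) \<in> measurable (\<Pi>\<^sub>M j\<in>{1..s}. lborel) (lborel :: real measure)"
    by (rule measurable_component_singleton)
  then have "(\<lambda>x. x j) \<in> borel_measurable (\<Pi>\<^sub>M j\<in>{1..s}. (lborel::real measure))" by simp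
  then show "(\<lambda>x. normal_density (lsq n Y j) (1 / sqrt (\<gamma> * col_sq n j)) (x j)) \<in> borel_measurable (\<Pi>\<^sub>M j\<in>{1..s}. lborel)"
    by (rule measurable_compose) simp
qed

lemma sets_cond_prior: "sets (cond_prior \<gamma> n Y s) = sets seq_space"
  by (simp add: cond_prior_def)

lemma nn_integral_cond_prior:
  assumes "s \<le> n" "\<gamma> > 0" and f: "f \<in> borel_measurable seq_space"
  shows "(\<integral>\<^sup>+\<theta>. f \<theta> \<partial>cond_prior \<gamma> n Y s)
    = (\<integral>\<^sup>+x. ennreal (cond_density \<gamma> n Y s x) * f (pad s x) \<partial>(\<Pi>\<^sub>M j\<in>{1..s}. lborel))"
proof -
  have "cond_prior \<gamma> n Y s = distr (density (\<Pi>\<^sub>M j\<in>{1..s}. lborel) (\<lambda>x. ennreal (cond_density \<gamma> n Y s x))) seq_space (pad s)"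
    unfolding cond_prior_def mvn_density_eq[OF assms(1,2)] zero_pad_vec cond_density_def ..
  then show ?thesis
    using measurable_pad f measurable_cond_density[of \<gamma> n Y s] measurable_compose[OF measurable_pad f]
    by (simp add: nn_integral_distr nn_integral_density)
qed

section \<open>Integration against finite mixtures\<close>

lemma emeasure_mixture:
  assumes K: "\<And>s. s \<in> {1..n} \<Longrightarrow> sets (K s) = sets seq_space" and A: "A \<in> sets seq_space"
  shows "emeasure (mixture n w K) A = (\<Sum>s=1..n. ennreal (w s) * emeasure (K s) A)"
  unfolding mixture_def
proof (rule emeasure_measure_of_sigma[OF _ _ _ A])
  show "sigma_algebra (space seq_space) (sets seq_space)" by (rule sets.sigma_algebra_axioms)
  \<comment> \<open>\<open>measure_of\<close> defaults to the zero measure unless the set function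
    is positive and countably additive.\<close>
  show "positive (sets seq_space) (\<lambda>A. \<Sum>s=1..n. ennreal (w s) * emeasure (K s) A)"
    by (simp add: positive_def)
  show "countably_additive (sets seq_space) (\<lambda>A. \<Sum>s=1..n. ennreal (w s) * emeasure (K s) A)"
  proof (rule countably_additiveI)
    fix F :: "nat \<Rightarrow> (nat \<Rightarrow> real) set"
    assume F: "range F \<subseteq> sets seq_space" "disjoint_family F" "\<Union> (range F) \<in> sets seq_space"
    have "(\<Sum>i. \<Sum>s=1..n. ennreal (w s) * emeasure (K s) (F i)) = (\<Sum>s=1..n. \<Sum>i. ennreal (w s) * emeasure (K s) (F i))"
      by (rule suminf_sum) simp
    also have "\<dots> = (\<Sum>s=1..n. ennreal (w s) * emeasure (K s) (\<Union> (range F)))"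
      using F K by (intro sum.cong refl) (simp add: suminf_emeasure)
    finally show "(\<Sum>i. \<Sum>s=1..n. ennreal (w s) * emeasure (K s) (F i)) = (\<Sum>s=1..n. ennreal (w s) * emeasure (K s) (\<Union> (range F)))" .
  qed
qed

lemma sets_mixture: "sets (mixture n w K) = sets seq_space"
  unfolding mixture_def by (rule sets.sets_measure_of_eq)

lemma nn_integral_mixture:
  assumes K: "\<And>s. s \<in> {1..n} \<Longrightarrow> sets (K s) = sets seq_space" and f: "f \<in> borel_measurable seq_space"
  shows "(\<integral>\<^sup>+\<theta>. f \<theta> \<partial>mixture n w K) = (\<Sum>s=1..n. ennreal (w s) * (\<integral>\<^sup>+\<theta>. f \<theta> \<partial>K s))"
  using f
proof (induction f rule: borel_measurable_induct)
  case (cong f g)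
  have "space (mixture n w K) = space seq_space" using sets_eq_imp_space_eq[OF sets_mixture] .
  then have "(\<integral>\<^sup>+\<theta>. f \<theta> \<partial>mixture n w K) = (\<integral>\<^sup>+\<theta>. g \<theta> \<partial>mixture n w K)"
    using cong by (intro nn_integral_cong) simp
  moreover have "(\<integral>\<^sup>+\<theta>. f \<theta> \<partial>K s) = (\<integral>\<^sup>+\<theta>. g \<theta> \<partial>K s)" if "s \<in> {1..n}" for s
    using cong sets_eq_imp_space_eq[OF K[OF that]] by (intro nn_integral_cong) simp
  ultimately show ?case using cong by simp
next
  case (set A)
  then show ?case using K emeasure_mixture[of n K A w] by (simp add: sets_mixture)
next
  case (mult u c)
  have "u \<in> borel_measurable (mixture n w K)" "\<And>s. s \<in> {1..n} \<Longrightarrow> u \<in> borel_measurable (K s)"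
    using mult.hyps(2) measurable_cong_sets[OF sets_mixture refl] measurable_cong_sets[OF K refl] by blast+
  then show ?case using mult by (simp add: nn_integral_cmult sum_distrib_left mult_ac)
next
  case (add u v)
  have "u \<in> borel_measurable (mixture n w K)" "\<And>s. s \<in> {1..n} \<Longrightarrow> u \<in> borel_measurable (K s)"
    "v \<in> borel_measurable (mixture n w K)" "\<And>s. s \<in> {1..n} \<Longrightarrow> v \<in> borel_measurable (K s)"
    using add.hyps(1,3) measurable_cong_sets[OF sets_mixture refl] measurable_cong_sets[OF K refl] by blast+
  then show ?case using add by (simp add: nn_integral_add sum.distrib distrib_left)
next
  case (seq U)
  have m: "U i \<in> borel_measurable (mixture n w K)" "\<And>s. s \<in> {1..n} \<Longrightarrow> U i \<in> borel_measurable (K s)" for i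
    using seq.hyps(1) measurable_cong_sets[OF sets_mixture refl] measurable_cong_sets[OF K refl] by blast+
  have "(\<integral>\<^sup>+\<theta>. (SUP i. U i) \<theta> \<partial>mixture n w K) = (SUP i. \<integral>\<^sup>+\<theta>. U i \<theta> \<partial>mixture n w K)"
    unfolding SUP_apply by (rule nn_integral_monotone_convergence_SUP[OF seq.hyps(3) m(1)])
  also have "\<dots> = (SUP i. \<Sum>s=1..n. ennreal (w s) * (\<integral>\<^sup>+\<theta>. U i \<theta> \<partial>K s))" using seq.IH by simp
  also have "\<dots> = (\<Sum>s=1..n. SUP i. ennreal (w s) * (\<integral>\<^sup>+\<theta>. U i \<theta> \<partial>K s))"
  proof (rule ennreal_SUP_sum)
    fix s assume "s \<in> {1..n}"
    show "incseq (\<lambda>i. ennreal (w s) * (\<integral>\<^sup>+\<theta>. U i \<theta> \<partial>K s))"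
      using seq.hyps(3) by (auto simp: incseq_def le_fun_def intro!: mult_left_mono nn_integral_mono)
  qed
  also have "\<dots> = (\<Sum>s=1..n. ennreal (w s) * (\<integral>\<^sup>+\<theta>. (SUP i. U i) \<theta> \<partial>K s))"
    unfolding SUP_apply using nn_integral_monotone_convergence_SUP[OF seq.hyps(3) m(2)]
    by (intro sum.cong refl) (simp add: SUP_mult_left_ennreal)
  finally show ?case .
qed

section \<open>Gaussian integrals\<close>

lemma nn_integral_normal_density:
  assumes "\<tau> > 0"
  shows "(\<integral>\<^sup>+x. ennreal (normal_density \<mu> \<tau> x) \<partial>lborel) = 1"
  using assms by (subst nn_integral_eq_integral) auto

text \<open>The tilted density is \<open>1 / q\<close> times the normal density with standard
  deviation \<open>\<tau> / q\<close>. Negative \<open>t\<close> yields normalising constants,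
  \<open>t = 1 / 4\<close> yields tail and noise bounds.\<close>

lemma nn_integral_normal_exp_square:
  assumes "\<tau> > 0" "t < 1 / 2"
  shows "(\<integral>\<^sup>+x. ennreal (normal_density \<mu> \<tau> x) * ennreal (exp (t * (x - \<mu>)\<^sup>2 / \<tau>\<^sup>2)) \<partial>lborel)
    = ennreal (1 / sqrt (1 - 2 * t))"
proof -
  define q where "q = sqrt (1 - 2 * t)"
  have q: "q > 0" "q\<^sup>2 = 1 - 2 * t" using assms by (auto simp: q_def)
  have "normal_density \<mu> \<tau> x * exp (t * (x - \<mu>)\<^sup>2 / \<tau>\<^sup>2) = 1 / q * normal_density \<mu> (\<tau> / q) x" for x
  proof -
    have "- (x - \<mu>)\<^sup>2 / (2 * \<tau>\<^sup>2) + t * (x - \<mu>)\<^sup>2 / \<tau>\<^sup>2 = - (x - \<mu>)\<^sup>2 * q\<^sup>2 / (2 * \<tau>\<^sup>2)"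
      unfolding q(2) using assms by (simp add: field_simps)
    moreover have "sqrt (2 * pi * (\<tau> / q)\<^sup>2) = sqrt (2 * pi * \<tau>\<^sup>2) / q"
      using q(1) assms by (simp add: real_sqrt_mult power_divide real_sqrt_divide)
    ultimately show ?thesis
      unfolding normal_density_def using q
      by (simp add: exp_add[symmetric] power_divide)
  qed
  then have "(\<integral>\<^sup>+x. ennreal (normal_density \<mu> \<tau> x) * ennreal (exp (t * (x - \<mu>)\<^sup>2 / \<tau>\<^sup>2)) \<partial>lborel)
     = (\<integral>\<^sup>+x. ennreal (1 / q) * ennreal (normal_density \<mu> (\<tau> / q) x) \<partial>lborel)"
    using q by (intro nn_integral_cong) (simp add: ennreal_mult[symmetric])
  also have "\<dots> = ennreal (1 / q)"
    using q assms by (simp add: nn_integral_cmult nn_integral_normal_density)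
  finally show ?thesis by (simp add: q_def)
qed

lemma nn_integral_normal_exp_linear:
  assumes "\<tau> > 0"
  shows "(\<integral>\<^sup>+x. ennreal (normal_density \<mu> \<tau> x) * ennreal (exp (t * ((x - \<mu>) / \<tau>))) \<partial>lborel) = ennreal (exp (t\<^sup>2 / 2))"
proof -
  have "normal_density \<mu> \<tau> x * exp (t * ((x - \<mu>) / \<tau>)) = exp (t\<^sup>2 / 2) * normal_density (\<mu> + t * \<tau>) \<tau> x" for x
  proof -
    have "- (x - \<mu>)\<^sup>2 / (2 * \<tau>\<^sup>2) + t * ((x - \<mu>) / \<tau>) = t\<^sup>2 / 2 + - (x - (\<mu> + t * \<tau>))\<^sup>2 / (2 * \<tau>\<^sup>2)"
      using assms by (simp add: field_simps power2_eq_square)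
    then show ?thesis unfolding normal_density_def by (simp add: exp_add[symmetric])
  qed
  then have "(\<integral>\<^sup>+x. ennreal (normal_density \<mu> \<tau> x) * ennreal (exp (t * ((x - \<mu>) / \<tau>))) \<partial>lborel)
     = (\<integral>\<^sup>+x. ennreal (exp (t\<^sup>2 / 2)) * ennreal (normal_density (\<mu> + t * \<tau>) \<tau> x) \<partial>lborel)"
    by (intro nn_integral_cong) (simp add: ennreal_mult[symmetric])
  also have "\<dots> = ennreal (exp (t\<^sup>2 / 2))"
    using assms by (simp add: nn_integral_cmult nn_integral_normal_density)
  finally show ?thesis .
qed

section \<open>The posterior as a mixture\<close>

lemma fseries_pad: "fseries (pad s x) t = (\<Sum>j=1..s. x j * fourier j t)"
proof -
  have "fseries (pad s x) t = (\<Sum>j<s. pad s x (Suc j) * fourier (Suc j) t)"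
    unfolding fseries_def by (rule suminf_finite) (auto simp: pad_def)
  also have "\<dots> = (\<Sum>j=1..s. x j * fourier j t)"
    by (simp add: sum.atLeast1_atMost_eq pad_def)
  finally show ?thesis .
qed

text \<open>The Gram form at the deviation from the least-squares estimator. Up to constants both
  the log-likelihood and the log-density of the conditional prior are multiples of it, which makes
  the model conjugate.\<close>

definition qform :: "nat \<Rightarrow> (nat \<Rightarrow> real) \<Rightarrow> nat \<Rightarrow> (nat \<Rightarrow> real) \<Rightarrow> real" where
  "qform n Y s x = (\<Sum>j=1..s. col_sq n j * (x j - lsq n Y j)\<^sup>2)"

lemma qform_eq:
  assumes "s \<le> n"
  shows "qform n Y s x = (\<Sum>j=1..s. (sqrt (col_sq n j) * x j - coord n Y j)\<^sup>2)"
  unfolding qform_def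
proof (intro sum.cong refl)
  fix j assume "j \<in> {1..s}"
  then have p: "col_sq n j > 0" using col_sq_pos[of j n] assms by simp
  have "sqrt (col_sq n j) * x j - coord n Y j = sqrt (col_sq n j) * (x j - lsq n Y j)"
    using p by (simp add: lsq_def algebra_simps)
  then show "col_sq n j * (x j - lsq n Y j)\<^sup>2 = (sqrt (col_sq n j) * x j - coord n Y j)\<^sup>2"
    using p by (simp add: power_mult_distrib)
qed

lemma qform_nonneg: "qform n Y s x \<ge> 0"
  unfolding qform_def col_sq_def by (intro sum_nonneg mult_nonneg_nonneg) auto

lemma measurable_qform: "qform n Y s \<in> borel_measurable (\<Pi>\<^sub>M j\<in>{1..s}. lborel)"
  unfolding qform_def[abs_def]
proof (intro borel_measurable_sum borel_measurable_times borel_measurable_power borel_measurable_diff borel_measurable_const)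
  fix j assume "j \<in> {1..s}"
  then have "(\<lambda>x. x j) \<in> measurable (\<Pi>\<^sub>M j\<in>{1..s}. lborel) (lborel :: real measure)"
    by (rule measurable_component_singleton)
  then show "(\<lambda>x. x j) \<in> borel_measurable (\<Pi>\<^sub>M j\<in>{1..s}. (lborel :: real measure))" by simp
qed

text \<open>Pythagoras splits the exponent into a part fixed by the size, which goes into the
  weights, and a part in \<open>x\<close>, which tilts the conditional prior.\<close>

lemma likelihood_pad:
  assumes "s \<le> n"
  shows "likelihood \<sigma> n Y (pad s x)
    = (1 / sqrt (2 * pi * \<sigma>\<^sup>2)) ^ n * exp (- (resid n Y s + qform n Y s x) / (2 * \<sigma>\<^sup>2))"
proof -
  have "(\<Sum>i=1..n. - (Y i - (\<Sum>j=1..s. x j * fourier j (design n i)))\<^sup>2 / (2 * \<sigma>\<^sup>2))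
      = - (resid n Y s + qform n Y s x) / (2 * \<sigma>\<^sup>2)"
    unfolding sum_divide_distrib[symmetric] sum_negf design_pythagoras[OF assms] qform_eq[OF assms] ..
  then show ?thesis
    unfolding likelihood_def normal_density_def fseries_pad prod.distrib
    by (simp add: exp_sum[symmetric])
qed

lemma measurable_fseries: "(\<lambda>\<theta>. fseries \<theta> t) \<in> borel_measurable seq_space"
proof -
  have "(\<lambda>\<theta>. \<theta> j) \<in> borel_measurable seq_space" for j
    by (rule measurable_component_singleton) simp
  then show ?thesis unfolding fseries_def
    by (intro borel_measurable_suminf borel_measurable_times borel_measurable_const)
qed

lemma measurable_likelihood: "likelihood \<sigma> n Y \<in> borel_measurable seq_space"
  unfolding likelihood_def[abs_def] normal_density_def
  using measurable_fseries by measurable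

lemma measurable_loss: "{\<theta>. emp_norm n (\<lambda>t. fseries \<theta> t - h t) > c} \<in> sets seq_space"
proof -
  have "(\<lambda>\<theta>. emp_norm n (\<lambda>t. fseries \<theta> t - h t)) \<in> borel_measurable seq_space"
    unfolding emp_norm_def using measurable_fseries by measurable
  then have "{\<theta> \<in> space seq_space. emp_norm n (\<lambda>t. fseries \<theta> t - h t) > c} \<in> sets seq_space"
    by measurable
  then show ?thesis by (simp add: space_PiM)
qed

lemma nn_integral_PiM_lborel_prod:
  assumes "finite I" "\<And>i. i \<in> I \<Longrightarrow> f i \<in> borel_measurable borel"
  shows "(\<integral>\<^sup>+x. (\<Prod>i\<in>I. f i (x i)) \<partial>(\<Pi>\<^sub>M i\<in>I. (lborel :: real measure))) = (\<Prod>i\<in>I. \<integral>\<^sup>+y. f i y \<partial>lborel)"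
proof -
  interpret product_sigma_finite "\<lambda>_. lborel :: real measure"
    by standard
  show ?thesis using assms by (intro product_nn_integral_prod) auto
qed

text \<open>In units of the prior standard deviation every coordinate is tilted by the same
  \<open>b / \<gamma>\<close>, and the data only shift the centre. Hence the result is a power of
  one constant.\<close>

lemma nn_integral_cond_density_exp:
  assumes "s \<le> n" "\<gamma> > 0" "b < \<gamma> / 2"
  shows "(\<integral>\<^sup>+x. ennreal (cond_density \<gamma> n Y s x) * ennreal (exp (b * qform n Y s x)) \<partial>(\<Pi>\<^sub>M j\<in>{1..s}. lborel))
    = ennreal ((1 / sqrt (1 - 2 * (b / \<gamma>))) ^ s)"
proof -
  define \<tau> where "\<tau> j = 1 / sqrt (\<gamma> * col_sq n j)" for j
  have \<tau>: "\<tau> j > 0" "b * col_sq n j = b / \<gamma> / (\<tau> j)\<^sup>2" if "j \<in> {1..s}" for j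
    using col_sq_pos[of j n] that assms by (auto simp: \<tau>_def power_divide)
  have "(\<integral>\<^sup>+x. ennreal (cond_density \<gamma> n Y s x) * ennreal (exp (b * qform n Y s x)) \<partial>(\<Pi>\<^sub>M j\<in>{1..s}. lborel))
      = (\<integral>\<^sup>+x. (\<Prod>j\<in>{1..s}. ennreal (normal_density (lsq n Y j) (\<tau> j) (x j))
            * ennreal (exp (b / \<gamma> * (x j - lsq n Y j)\<^sup>2 / (\<tau> j)\<^sup>2))) \<partial>(\<Pi>\<^sub>M j\<in>{1..s}. lborel))"
  proof (intro nn_integral_cong)
    fix x :: "nat \<Rightarrow> real"
    have "exp (b * qform n Y s x) = (\<Prod>j=1..s. exp (b / \<gamma> * (x j - lsq n Y j)\<^sup>2 / (\<tau> j)\<^sup>2))"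
    proof -
      have "b * qform n Y s x = (\<Sum>j=1..s. b / \<gamma> * (x j - lsq n Y j)\<^sup>2 / (\<tau> j)\<^sup>2)"
        unfolding qform_def sum_distrib_left
        by (intro sum.cong refl) (simp add: mult.assoc[symmetric] \<tau>(2))
      then show ?thesis by (simp add: exp_sum)
    qed
    then show "ennreal (cond_density \<gamma> n Y s x) * ennreal (exp (b * qform n Y s x))
      = (\<Prod>j\<in>{1..s}. ennreal (normal_density (lsq n Y j) (\<tau> j) (x j))
            * ennreal (exp (b / \<gamma> * (x j - lsq n Y j)\<^sup>2 / (\<tau> j)\<^sup>2)))"
      unfolding cond_density_def \<tau>_def[symmetric]
      by (simp add: prod.distrib[symmetric] ennreal_mult[symmetric] prod_nonneg prod_ennreal)
  qed
  also have "\<dots> = (\<Prod>j\<in>{1..s}. \<integral>\<^sup>+y. ennreal (normal_density (lsq n Y j) (\<tau> j) y)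
            * ennreal (exp (b / \<gamma> * (y - lsq n Y j)\<^sup>2 / (\<tau> j)\<^sup>2)) \<partial>lborel)"
    by (rule nn_integral_PiM_lborel_prod) measurable
  also have "\<dots> = (\<Prod>j\<in>{1..s}. ennreal (1 / sqrt (1 - 2 * (b / \<gamma>))))"
    using assms by (intro prod.cong refl nn_integral_normal_exp_square \<tau>) (simp_all add: field_simps)
  also have "\<dots> = ennreal ((1 / sqrt (1 - 2 * (b / \<gamma>))) ^ s)"
    using assms by (subst prod_ennreal) (auto simp: field_simps)
  finally show ?thesis .
qed

text \<open>The unnormalised posterior mass of \<open>A\<close> at size \<open>s\<close> with the
  residual factor taken out; \<open>a\<close> records the type of regularization.\<close>

definition cond_mass ::
  "real \<Rightarrow> nat \<Rightarrow> (nat \<Rightarrow> real) \<Rightarrow> real \<Rightarrow> nat \<Rightarrow> (nat \<Rightarrow> real) set \<Rightarrow> ennreal" where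
  "cond_mass \<gamma> n Y a s A = (\<integral>\<^sup>+x. ennreal (cond_density \<gamma> n Y s x) *
     (ennreal (exp (- a * qform n Y s x)) * indicator A (pad s x)) \<partial>(\<Pi>\<^sub>M j\<in>{1..s}. lborel))"

lemma cond_mass_UNIV:
  assumes "s \<le> n" "\<gamma> > 0" "a \<ge> 0"
  shows "cond_mass \<gamma> n Y a s UNIV = ennreal ((1 / sqrt (1 + 2 * (a / \<gamma>))) ^ s)"
  using nn_integral_cond_density_exp[OF assms(1,2), of "- a" Y] assms(2,3)
  unfolding cond_mass_def by (simp add: less_le_trans[of _ 0])

lemma cond_mass_mono: "A \<subseteq> A' \<Longrightarrow> cond_mass \<gamma> n Y a s A \<le> cond_mass \<gamma> n Y a s A'"
  unfolding cond_mass_def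
  by (intro nn_integral_mono mult_left_mono) (auto simp: indicator_def)

lemma cond_mass_le_1:
  assumes "s \<le> n" "\<gamma> > 0" "a \<ge> 0"
  shows "cond_mass \<gamma> n Y a s A \<le> 1"
proof -
  have "1 \<le> sqrt (1 + 2 * (a / \<gamma>))" using assms by simp
  then have "(1 / sqrt (1 + 2 * (a / \<gamma>))) ^ s \<le> 1"
    by (intro power_le_one) (auto simp: divide_le_eq_1)
  then show ?thesis
    using cond_mass_mono[of A UNIV \<gamma> n Y a s] unfolding cond_mass_UNIV[OF assms]
    by (metis dual_order.trans ennreal_le_1 top_greatest)
qed

text \<open>A Chernoff bound under the conditional prior with tilt \<open>\<gamma> / 4\<close>, half
  the critical value, which costs \<open>sqrt 2\<close> per coordinate. The likelihood factor is
  bounded by 1.\<close>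

lemma cond_mass_tail_le:
  assumes "s \<le> n" "\<gamma> > 0" "a \<ge> 0" and far: "\<And>x. pad s x \<in> A \<Longrightarrow> qform n Y s x \<ge> R"
  shows "cond_mass \<gamma> n Y a s A \<le> ennreal (sqrt 2 ^ s * exp (- \<gamma> / 4 * R))"
proof -
  let ?P = "\<Pi>\<^sub>M j\<in>{1..s}. lborel :: real measure"
  have "cond_mass \<gamma> n Y a s A \<le> (\<integral>\<^sup>+x. ennreal (exp (- \<gamma> / 4 * R)) *
     (ennreal (cond_density \<gamma> n Y s x) * ennreal (exp (\<gamma> / 4 * qform n Y s x))) \<partial>?P)"
    unfolding cond_mass_def
  proof (intro nn_integral_mono)
    fix x :: "nat \<Rightarrow> real"
    have "ennreal (exp (- a * qform n Y s x)) * indicator A (pad s x) \<le> ennreal (exp (- \<gamma> / 4 * R) * exp (\<gamma> / 4 * qform n Y s x))"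
    proof (cases "pad s x \<in> A")
      case True
      have "exp (- a * qform n Y s x) \<le> 1" using qform_nonneg[of n Y s x] assms by simp
      also have "1 \<le> exp (- \<gamma> / 4 * R + \<gamma> / 4 * qform n Y s x)"
        using far[OF True] assms by simp
      finally have "exp (- a * qform n Y s x) \<le> exp (- \<gamma> / 4 * R) * exp (\<gamma> / 4 * qform n Y s x)"
        unfolding exp_add .
      then show ?thesis using True by (simp only: indicator_simps mult_1_right ennreal_leI)
    qed simp
    then have "ennreal (cond_density \<gamma> n Y s x) * (ennreal (exp (- a * qform n Y s x)) * indicator A (pad s x))
      \<le> ennreal (cond_density \<gamma> n Y s x) * ennreal (exp (- \<gamma> / 4 * R) * exp (\<gamma> / 4 * qform n Y s x))"
      by (intro mult_left_mono) auto
    then show "ennreal (cond_density \<gamma> n Y s x) * (ennreal (exp (- a * qform n Y s x)) * indicator A (pad s x))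
      \<le> ennreal (exp (- \<gamma> / 4 * R)) * (ennreal (cond_density \<gamma> n Y s x) * ennreal (exp (\<gamma> / 4 * qform n Y s x)))"
      by (simp add: ennreal_mult mult_ac)
  qed
  also have "\<dots> = ennreal (exp (- \<gamma> / 4 * R)) * ennreal ((1 / sqrt (1 - 2 * ((\<gamma> / 4) / \<gamma>))) ^ s)"
  proof (subst nn_integral_cmult)
    have "qform n Y s \<in> borel_measurable ?P" by (rule measurable_qform)
    then show "(\<lambda>x. ennreal (cond_density \<gamma> n Y s x) * ennreal (exp (\<gamma> / 4 * qform n Y s x))) \<in> borel_measurable ?P"
      using measurable_cond_density[of \<gamma> n Y s] by measurable
  qed (use nn_integral_cond_density_exp[OF assms(1,2), of "\<gamma> / 4"] assms in simp)
  also have "\<dots> = ennreal (sqrt 2 ^ s * exp (- \<gamma> / 4 * R))"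
    using assms by (simp add: ennreal_mult[symmetric] real_sqrt_divide mult.commute)
  finally show ?thesis .
qed

definition post_weight :: "real \<Rightarrow> (real \<Rightarrow> real) \<Rightarrow> real \<Rightarrow> nat \<Rightarrow> (nat \<Rightarrow> real) \<Rightarrow> nat \<Rightarrow> real" where
  "post_weight \<sigma> g \<alpha> n Y s = exp (- g (real s) * real s - \<alpha> * resid n Y s / (2 * \<sigma>\<^sup>2))"

text \<open>The common core of both regularizations: \<open>F\<close> is the integrand left by the
  regularization, and \<open>K\<close> collects everything that varies neither with the size nor
  with \<open>x\<close>.\<close>

lemma nn_integral_mixture_cond_prior:
  assumes "\<gamma> > 0" and F: "F \<in> borel_measurable seq_space" and A: "A \<in> sets seq_space"
    and eq: "\<And>s x. s \<in> {1..n} \<Longrightarrow>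
      ennreal (w s) * F (pad s x) = K * ennreal (W s) * ennreal (exp (- a * qform n Y s x))"
  shows "(\<integral>\<^sup>+\<theta>. F \<theta> * indicator A \<theta> \<partial>mixture n w (cond_prior \<gamma> n Y))
    = K * (\<Sum>s=1..n. ennreal (W s) * cond_mass \<gamma> n Y a s A)"
proof -
  have FA: "(\<lambda>\<theta>. F \<theta> * indicator A \<theta>) \<in> borel_measurable seq_space"
    using F A by simp
  have "ennreal (w s) * (\<integral>\<^sup>+\<theta>. F \<theta> * indicator A \<theta> \<partial>cond_prior \<gamma> n Y s)
      = K * (ennreal (W s) * cond_mass \<gamma> n Y a s A)" if s: "s \<in> {1..n}" for s
  proof -
    let ?P = "\<Pi>\<^sub>M j\<in>{1..s}. lborel :: real measure"
    have cd: "(\<lambda>x. ennreal (cond_density \<gamma> n Y s x)) \<in> borel_measurable ?P"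
      using measurable_cond_density by measurable
    have FAp: "(\<lambda>x. F (pad s x) * indicator A (pad s x)) \<in> borel_measurable ?P"
      using measurable_compose[OF measurable_pad FA] by simp
    have iA: "(\<lambda>x. indicator A (pad s x) :: ennreal) \<in> borel_measurable ?P"
      using measurable_compose[OF measurable_pad borel_measurable_indicator[OF A]] by simp
    have "ennreal (w s) * (\<integral>\<^sup>+\<theta>. F \<theta> * indicator A \<theta> \<partial>cond_prior \<gamma> n Y s)
      = (\<integral>\<^sup>+x. ennreal (w s) * (ennreal (cond_density \<gamma> n Y s x) * (F (pad s x) * indicator A (pad s x))) \<partial>?P)"
      using s assms(1) nn_integral_cond_prior[OF _ assms(1) FA, of s n Y] cd FAp
      by (subst nn_integral_cmult) (auto intro: borel_measurable_times_ennreal)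
    also have "\<dots> = (\<integral>\<^sup>+x. K * ennreal (W s) * (ennreal (cond_density \<gamma> n Y s x) * (ennreal (exp (- a * qform n Y s x)) * indicator A (pad s x))) \<partial>?P)"
    proof (intro nn_integral_cong)
      fix x :: "nat \<Rightarrow> real"
      have "ennreal (w s) * (ennreal (cond_density \<gamma> n Y s x) * (F (pad s x) * indicator A (pad s x)))
        = (ennreal (w s) * F (pad s x)) * (ennreal (cond_density \<gamma> n Y s x) * indicator A (pad s x))"
        by (simp only: mult_ac)
      then show "ennreal (w s) * (ennreal (cond_density \<gamma> n Y s x) * (F (pad s x) * indicator A (pad s x)))
        = K * ennreal (W s) * (ennreal (cond_density \<gamma> n Y s x) * (ennreal (exp (- a * qform n Y s x)) * indicator A (pad s x)))"
        unfolding eq[OF s] by (simp only: mult_ac)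
    qed
    also have "\<dots> = K * ennreal (W s) * cond_mass \<gamma> n Y a s A"
      unfolding cond_mass_def
    proof (rule nn_integral_cmult)
      have "qform n Y s \<in> borel_measurable ?P" by (rule measurable_qform)
      then show "(\<lambda>x. ennreal (cond_density \<gamma> n Y s x) * (ennreal (exp (- a * qform n Y s x)) * indicator A (pad s x))) \<in> borel_measurable ?P"
        using cd iA by measurable
    qed
    finally show ?thesis by (simp add: mult.assoc)
  qed
  then show ?thesis
    unfolding nn_integral_mixture[OF sets_cond_prior FA] sum_distrib_left by (intro sum.cong refl) simp
qed

text \<open>The likelihood is left with the power \<alpha>, so residual and quadratic form are both
  scaled by \<alpha>.\<close>

lemma type1_integral:
  assumes "\<sigma> > 0" "\<gamma> > 0" "n \<ge> 1"
  shows "\<exists>K>0. \<forall>A\<in>sets seq_space.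
    (\<integral>\<^sup>+\<theta>. ennreal (likelihood \<sigma> n Y \<theta>) * indicator A \<theta> \<partial>type1_prior \<sigma> \<gamma> g \<alpha> n Y)
      = ennreal K * (\<Sum>s=1..n. ennreal (post_weight \<sigma> g \<alpha> n Y s) * cond_mass \<gamma> n Y (\<alpha> / (2 * \<sigma>\<^sup>2)) s A)"
proof -
  define c where "c = (1 / sqrt (2 * pi * \<sigma>\<^sup>2)) ^ n"
  have c: "c > 0" using assms by (simp add: c_def)
  define Z where "Z = (\<Sum>s=1..n. exp (- g (real s) * real s))"
  have Z: "Z > 0" unfolding Z_def using assms by (intro sum_pos) auto
  define F where "F \<theta> = ennreal (1 / likelihood \<sigma> n Y \<theta> powr (1 - \<alpha>)) * ennreal (likelihood \<sigma> n Y \<theta>)" for \<theta>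
  have F: "F \<in> borel_measurable seq_space"
    unfolding F_def using measurable_likelihood by measurable
  have eq: "ennreal (size_prior g n s) * F (pad s x) = ennreal (c powr \<alpha> / Z) * ennreal (post_weight \<sigma> g \<alpha> n Y s)
      * ennreal (exp (- (\<alpha> / (2 * \<sigma>\<^sup>2)) * qform n Y s x))" if s: "s \<in> {1..n}" for s x
  proof -
    define L where "L = likelihood \<sigma> n Y (pad s x)"
    define e where "e = - (resid n Y s + qform n Y s x) / (2 * \<sigma>\<^sup>2)"
    have L: "L = c * exp e" using s by (simp add: L_def c_def e_def likelihood_pad)
    then have Lp: "L > 0" using c by simp
    have "1 / L powr (1 - \<alpha>) * L = L powr \<alpha>"
      using Lp by (simp add: powr_diff)
    also have "\<dots> = c powr \<alpha> * exp (\<alpha> * e)" unfolding L using c by (simp add: powr_mult powr_def[of "exp e"])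
    finally have "F (pad s x) = ennreal (c powr \<alpha> * exp (\<alpha> * e))"
      unfolding F_def L_def[symmetric] using Lp by (simp add: ennreal_mult[symmetric])
    moreover have "exp (- g (real s) * real s) * exp (\<alpha> * e) = post_weight \<sigma> g \<alpha> n Y s * exp (- (\<alpha> / (2 * \<sigma>\<^sup>2)) * qform n Y s x)"
      unfolding post_weight_def exp_add[symmetric] e_def by (simp add: add_divide_distrib diff_divide_distrib distrib_left right_diff_distrib)
    ultimately show ?thesis using c Z
      unfolding size_prior_def normalize_weights_def Z_def[symmetric]
      by (simp add: ennreal_mult[symmetric] post_weight_def divide_simps mult_ac del: mult_minus_left)
  qed
  have m1: "(\<lambda>\<theta>. ennreal (1 / likelihood \<sigma> n Y \<theta> powr (1 - \<alpha>))) \<in> borel_measurable (emp_prior \<gamma> g n Y)"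
    unfolding emp_prior_def measurable_cong_sets[OF sets_mixture refl] using measurable_likelihood by measurable
  have "(\<integral>\<^sup>+\<theta>. ennreal (likelihood \<sigma> n Y \<theta>) * indicator A \<theta> \<partial>type1_prior \<sigma> \<gamma> g \<alpha> n Y)
      = ennreal (c powr \<alpha> / Z) * (\<Sum>s=1..n. ennreal (post_weight \<sigma> g \<alpha> n Y s) * cond_mass \<gamma> n Y (\<alpha> / (2 * \<sigma>\<^sup>2)) s A)"
    if A: "A \<in> sets seq_space" for A
  proof -
    have m2: "(\<lambda>\<theta>. ennreal (likelihood \<sigma> n Y \<theta>) * indicator A \<theta>) \<in> borel_measurable (emp_prior \<gamma> g n Y)"
      unfolding emp_prior_def measurable_cong_sets[OF sets_mixture refl] using measurable_likelihood A by measurable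
    have "(\<integral>\<^sup>+\<theta>. ennreal (likelihood \<sigma> n Y \<theta>) * indicator A \<theta> \<partial>type1_prior \<sigma> \<gamma> g \<alpha> n Y)
      = (\<integral>\<^sup>+\<theta>. F \<theta> * indicator A \<theta> \<partial>mixture n (size_prior g n) (cond_prior \<gamma> n Y))"
      unfolding type1_prior_def nn_integral_density[OF m1 m2]
      unfolding F_def emp_prior_def by (simp add: mult.assoc)
    also have "\<dots> = ennreal (c powr \<alpha> / Z) * (\<Sum>s=1..n. ennreal (post_weight \<sigma> g \<alpha> n Y s) * cond_mass \<gamma> n Y (\<alpha> / (2 * \<sigma>\<^sup>2)) s A)"
      using Z eq by (intro nn_integral_mixture_cond_prior assms F A)
        (auto simp: size_prior_def normalize_weights_def Z_def[symmetric])
    finally show ?thesis .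
  qed
  moreover have "c powr \<alpha> / Z > 0" using c Z by simp
  ultimately show ?thesis by (intro exI[of _ "c powr \<alpha> / Z"] conjI ballI)
qed

lemma post_weight_nonneg: "post_weight \<sigma> g \<alpha> n Y s \<ge> 0"
  by (simp add: post_weight_def)

text \<open>At the least-squares estimator \<open>qform\<close> vanishes. The division therefore
  removes the share \<open>1 - \<alpha>\<close> of the residual and leaves the quadratic form at
  full strength.\<close>

lemma type2_integral:
  assumes "\<sigma> > 0" "\<gamma> > 0" "n \<ge> 1"
  shows "\<exists>K>0. \<forall>A\<in>sets seq_space.
    (\<integral>\<^sup>+\<theta>. ennreal (likelihood \<sigma> n Y \<theta>) * indicator A \<theta> \<partial>type2_prior \<sigma> \<gamma> g \<alpha> n Y)
      = ennreal K * (\<Sum>s=1..n. ennreal (post_weight \<sigma> g \<alpha> n Y s) * cond_mass \<gamma> n Y (1 / (2 * \<sigma>\<^sup>2)) s A)"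
proof -
  define c where "c = (1 / sqrt (2 * pi * \<sigma>\<^sup>2)) ^ n"
  have c: "c > 0" using assms by (simp add: c_def)
  define Z where "Z = (\<Sum>s=1..n. exp (- g (real s) * real s))"
  have Z: "Z > 0" unfolding Z_def using assms by (intro sum_pos) auto
  define u where "u s = size_prior g n s / likelihood \<sigma> n Y (zero_pad (lse n s Y)) powr (1 - \<alpha>)" for s
  have u: "u s = exp (- g (real s) * real s) / Z * c powr (\<alpha> - 1) * exp ((1 - \<alpha>) * resid n Y s / (2 * \<sigma>\<^sup>2))"
    if s: "s \<in> {1..n}" for s
  proof -
    have "zero_pad (lse n s Y) = pad s (lsq n Y)"
      using s by (simp add: lse_eq zero_pad_vec)
    moreover have "qform n Y s (lsq n Y) = 0" by (simp add: qform_def)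
    ultimately have "likelihood \<sigma> n Y (zero_pad (lse n s Y)) = c * exp (- resid n Y s / (2 * \<sigma>\<^sup>2))"
      using s by (simp add: likelihood_pad c_def)
    then have L: "likelihood \<sigma> n Y (zero_pad (lse n s Y)) powr (1 - \<alpha>)
      = c powr (1 - \<alpha>) * exp ((1 - \<alpha>) * (- resid n Y s / (2 * \<sigma>\<^sup>2)))"
      using c by (simp add: powr_mult powr_def[of "exp _"])
    have cc: "c powr (\<alpha> - 1) = inverse (c powr (1 - \<alpha>))"
      using powr_minus[of c "1 - \<alpha>"] by (simp only: minus_diff_eq)
    have "(1 - \<alpha>) * (- resid n Y s / (2 * \<sigma>\<^sup>2)) = - ((1 - \<alpha>) * resid n Y s / (2 * \<sigma>\<^sup>2))" by simp
    then have E: "inverse (exp ((1 - \<alpha>) * (- resid n Y s / (2 * \<sigma>\<^sup>2)))) = exp ((1 - \<alpha>) * resid n Y s / (2 * \<sigma>\<^sup>2))"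
      by (simp only: exp_minus inverse_inverse_eq)
    show ?thesis
      unfolding u_def size_prior_def normalize_weights_def Z_def[symmetric] L cc E[symmetric]
      by (simp only: divide_inverse inverse_mult_distrib mult.assoc)
  qed
  have upos: "u s > 0" if "s \<in> {1..n}" for s unfolding u[OF that] using c Z by simp
  define Z2 where "Z2 = (\<Sum>s=1..n. u s)"
  have Z2: "Z2 > 0" unfolding Z2_def using upos assms by (intro sum_pos) auto
  define F where "F \<theta> = ennreal (likelihood \<sigma> n Y \<theta>)" for \<theta>
  have F: "F \<in> borel_measurable seq_space"
    unfolding F_def using measurable_likelihood by measurable
  have eq: "ennreal (normalize_weights n u s) * F (pad s x) = ennreal (c powr \<alpha> / (Z * Z2)) * ennreal (post_weight \<sigma> g \<alpha> n Y s)
      * ennreal (exp (- (1 / (2 * \<sigma>\<^sup>2)) * qform n Y s x))" if s: "s \<in> {1..n}" for s x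
  proof -
    have L: "likelihood \<sigma> n Y (pad s x) = c * exp (- (resid n Y s + qform n Y s x) / (2 * \<sigma>\<^sup>2))"
      using s by (simp add: c_def likelihood_pad)
    have cc: "c powr (\<alpha> - 1) * c = c powr \<alpha>" using c by (simp add: powr_diff)
    have E: "exp (- g (real s) * real s) * exp ((1 - \<alpha>) * resid n Y s / (2 * \<sigma>\<^sup>2)) * exp (- (resid n Y s + qform n Y s x) / (2 * \<sigma>\<^sup>2))
        = post_weight \<sigma> g \<alpha> n Y s * exp (- (1 / (2 * \<sigma>\<^sup>2)) * qform n Y s x)"
      unfolding post_weight_def exp_add[symmetric] by (simp add: add_divide_distrib diff_divide_distrib left_diff_distrib)
    have "u s * likelihood \<sigma> n Y (pad s x) = (c powr (\<alpha> - 1) * c) / Z *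
        (exp (- g (real s) * real s) * exp ((1 - \<alpha>) * resid n Y s / (2 * \<sigma>\<^sup>2)) * exp (- (resid n Y s + qform n Y s x) / (2 * \<sigma>\<^sup>2)))"
      unfolding u[OF s] L by (simp only: divide_inverse mult_ac)
    then have "u s * likelihood \<sigma> n Y (pad s x) = c powr \<alpha> / Z * (post_weight \<sigma> g \<alpha> n Y s * exp (- (1 / (2 * \<sigma>\<^sup>2)) * qform n Y s x))"
      unfolding cc E .
    from arg_cong[OF this, of "\<lambda>r. r / Z2"] have "u s / Z2 * likelihood \<sigma> n Y (pad s x)
       = c powr \<alpha> / (Z * Z2) * post_weight \<sigma> g \<alpha> n Y s * exp (- (1 / (2 * \<sigma>\<^sup>2)) * qform n Y s x)"
      by (simp only: times_divide_eq_left times_divide_eq_right divide_divide_eq_left mult.assoc)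
    moreover have "likelihood \<sigma> n Y (pad s x) \<ge> 0" using s by (simp add: likelihood_pad)
    ultimately show ?thesis
      unfolding normalize_weights_def Z2_def[symmetric] F_def using upos[OF s] Z Z2
      by (simp only: ennreal_mult[symmetric] divide_nonneg_pos mult_nonneg_nonneg less_imp_le mult_pos_pos
          powr_ge_zero exp_ge_zero post_weight_nonneg)
  qed
  have "(\<integral>\<^sup>+\<theta>. ennreal (likelihood \<sigma> n Y \<theta>) * indicator A \<theta> \<partial>type2_prior \<sigma> \<gamma> g \<alpha> n Y)
      = ennreal (c powr \<alpha> / (Z * Z2)) * (\<Sum>s=1..n. ennreal (post_weight \<sigma> g \<alpha> n Y s) * cond_mass \<gamma> n Y (1 / (2 * \<sigma>\<^sup>2)) s A)"
    if A: "A \<in> sets seq_space" for A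
    unfolding type2_prior_def F_def[symmetric] u_def[symmetric]
    using Z2 upos eq by (intro nn_integral_mixture_cond_prior assms F A)
      (auto simp: normalize_weights_def Z2_def[symmetric])
  moreover have "c powr \<alpha> / (Z * Z2) > 0" using c Z Z2 by simp
  ultimately show ?thesis by (intro exI[of _ "c powr \<alpha> / (Z * Z2)"] conjI ballI)
qed

text \<open>The constants of the two integral formulas cancel in the quotient. Only the range of
  \<open>a\<close> is kept, so later estimates treat both types at once.\<close>

lemma posterior_eq:
  assumes "\<sigma> > 0" "\<gamma> > 0" "n \<ge> 1" "0 < \<alpha>" "\<alpha> < 1"
    and Prior: "Prior \<in> {type1_prior \<sigma> \<gamma> g \<alpha>, type2_prior \<sigma> \<gamma> g \<alpha>}"
    and A: "A \<in> sets seq_space"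
  obtains a where "0 \<le> a" "a \<le> 1 / (2 * \<sigma>\<^sup>2)"
    "posterior \<sigma> n Y (Prior n Y) A
      = (\<Sum>s=1..n. ennreal (post_weight \<sigma> g \<alpha> n Y s) * cond_mass \<gamma> n Y a s A)
        / (\<Sum>s=1..n. ennreal (post_weight \<sigma> g \<alpha> n Y s) * cond_mass \<gamma> n Y a s UNIV)"
proof -
  have "\<exists>a. 0 \<le> a \<and> a \<le> 1 / (2 * \<sigma>\<^sup>2) \<and> (\<exists>K>0. \<forall>A\<in>sets seq_space.
    (\<integral>\<^sup>+\<theta>. ennreal (likelihood \<sigma> n Y \<theta>) * indicator A \<theta> \<partial>Prior n Y)
      = ennreal K * (\<Sum>s=1..n. ennreal (post_weight \<sigma> g \<alpha> n Y s) * cond_mass \<gamma> n Y a s A))"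
    using Prior
  proof (elim insertE emptyE)
    assume P: "Prior = type1_prior \<sigma> \<gamma> g \<alpha>"
    have "0 \<le> \<alpha> / (2 * \<sigma>\<^sup>2)" "\<alpha> / (2 * \<sigma>\<^sup>2) \<le> 1 / (2 * \<sigma>\<^sup>2)" using assms(4,5) by (auto intro: divide_right_mono)
    then show ?thesis unfolding P using type1_integral[OF assms(1-3), where Y = Y and g = g and \<alpha> = \<alpha>]
      by - (rule exI[of _ "\<alpha> / (2 * \<sigma>\<^sup>2)"], intro conjI)
  next
    assume P: "Prior = type2_prior \<sigma> \<gamma> g \<alpha>"
    have "0 \<le> 1 / (2 * \<sigma>\<^sup>2)" by simp
    then show ?thesis unfolding P using type2_integral[OF assms(1-3), where Y = Y and g = g and \<alpha> = \<alpha>]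
      by - (rule exI[of _ "1 / (2 * \<sigma>\<^sup>2)"], intro conjI order_refl)
  qed
  then obtain a K where a: "0 \<le> a" "a \<le> 1 / (2 * \<sigma>\<^sup>2)" and K: "K > 0"
    and int: "\<And>A. A \<in> sets seq_space \<Longrightarrow> (\<integral>\<^sup>+\<theta>. ennreal (likelihood \<sigma> n Y \<theta>) * indicator A \<theta> \<partial>Prior n Y)
      = ennreal K * (\<Sum>s=1..n. ennreal (post_weight \<sigma> g \<alpha> n Y s) * cond_mass \<gamma> n Y a s A)"
    by blast
  have "(UNIV :: (nat \<Rightarrow> real) set) \<in> sets seq_space"
    using sets.top[of seq_space] by (simp add: space_PiM)
  from int[OF this] have "(\<integral>\<^sup>+\<theta>. ennreal (likelihood \<sigma> n Y \<theta>) \<partial>Prior n Y)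
      = ennreal K * (\<Sum>s=1..n. ennreal (post_weight \<sigma> g \<alpha> n Y s) * cond_mass \<gamma> n Y a s UNIV)" by simp
  then have "posterior \<sigma> n Y (Prior n Y) A
      = (\<Sum>s=1..n. ennreal (post_weight \<sigma> g \<alpha> n Y s) * cond_mass \<gamma> n Y a s A)
        / (\<Sum>s=1..n. ennreal (post_weight \<sigma> g \<alpha> n Y s) * cond_mass \<gamma> n Y a s UNIV)"
    unfolding posterior_def int[OF A] using divide_mult_eq[of "ennreal K"] K
    by (simp add: mult.commute[of "ennreal K"])
  then show ?thesis by (rule that[OF a])
qed

section \<open>Noise\<close>

lemma measurable_coord_noise:
  "(\<lambda>Y. coord n (\<lambda>i. (Y i - f (design n i)) / \<sigma>) j) \<in> borel_measurable (data_law \<sigma> n f)"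
proof -
  have "(\<lambda>Y. Y i) \<in> borel_measurable (data_law \<sigma> n f)" if "i \<in> {1..n}" for i
  proof -
    have "(\<lambda>Y. Y i) \<in> measurable (data_law \<sigma> n f) (density lborel (\<lambda>y. ennreal (normal_density (f (design n i)) \<sigma> y)))"
      unfolding data_law_def using that by (rule measurable_component_singleton)
    then show ?thesis by simp
  qed
  then show ?thesis
    unfolding coord_def
    by (intro borel_measurable_divide borel_measurable_sum borel_measurable_times borel_measurable_diff borel_measurable_const)
qed

text \<open>
  The identity \<open>exp (x\<^sup>2 / 4) = E (exp (x * \<xi> / sqrt 2))\<close> for a standard normal \<open>\<xi>\<close> linearizes the square,
  so that the exponential moment of a projection of the noise follows from Fubini and the
  orthonormality of the directions, without rotation invariance of the normal law.
\<close>

lemma nn_integral_exp_noise: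
  assumes "\<sigma> > 0" "s \<le> n"
  shows "(\<integral>\<^sup>+Y. ennreal (exp ((\<Sum>j=1..s. (coord n (\<lambda>i. (Y i - f (design n i)) / \<sigma>) j)\<^sup>2) / 4)) \<partial>data_law \<sigma> n f)
    = ennreal (sqrt 2 ^ s)"
proof -
  define D where "D i = density lborel (\<lambda>y. ennreal (normal_density (f (design n i)) \<sigma> y))" for i
  define P where "P = (\<Pi>\<^sub>M j\<in>{1..s}. (lborel :: real measure))"
  define X where "X Y j = coord n (\<lambda>i. (Y i - f (design n i)) / \<sigma>) j" for Y j
  define H where "H \<xi> Y = (\<Prod>j=1..s. ennreal (std_normal_density (\<xi> j)) * ennreal (exp (X Y j / sqrt 2 * ((\<xi> j - 0) / 1))))" for \<xi> Y
  have dl: "data_law \<sigma> n f = Pi\<^sub>M {1..n} D" unfolding data_law_def D_def[abs_def] ..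
  have pD: "prob_space (D i)" for i unfolding D_def by (rule prob_space_normal_density) fact
  interpret DD: product_sigma_finite D
    by (intro product_sigma_finite.intro prob_space_imp_sigma_finite pD)
  interpret LL: product_sigma_finite "\<lambda>_. lborel :: real measure" by standard
  have sfP: "sigma_finite_measure P" unfolding P_def by (rule LL.sigma_finite) simp
  have sfD: "sigma_finite_measure (Pi\<^sub>M {1..n} D)" by (rule DD.sigma_finite) simp
  interpret PD: pair_sigma_finite P "Pi\<^sub>M {1..n} D" using sfP sfD by (rule pair_sigma_finite.intro)
  have mX: "(\<lambda>Y. X Y j) \<in> borel_measurable (Pi\<^sub>M {1..n} D)" for j
    using measurable_coord_noise[of n f \<sigma> j] unfolding X_def dl .
  have mxi: "(\<lambda>\<xi>. \<xi> j) \<in> borel_measurable P" if "j \<in> {1..s}" for j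
  proof -
    have "(\<lambda>\<xi>. \<xi> j) \<in> measurable P (lborel :: real measure)" unfolding P_def
      using that by (rule measurable_component_singleton)
    then show ?thesis by simp
  qed
  have mH: "case_prod H \<in> borel_measurable (P \<Otimes>\<^sub>M Pi\<^sub>M {1..n} D)"
    unfolding H_def[abs_def] case_prod_beta
  proof (intro borel_measurable_prod_ennreal)
    fix j assume j: "j \<in> {1..s}"
    have 1: "(\<lambda>z. X (snd z) j) \<in> borel_measurable (P \<Otimes>\<^sub>M Pi\<^sub>M {1..n} D)"
      by (rule measurable_compose[OF measurable_snd mX])
    have 2: "(\<lambda>z. fst z j) \<in> borel_measurable (P \<Otimes>\<^sub>M Pi\<^sub>M {1..n} D)"
      by (rule measurable_compose[OF measurable_fst mxi[OF j]])
    have 3: "(\<lambda>z. std_normal_density (fst z j)) \<in> borel_measurable (P \<Otimes>\<^sub>M Pi\<^sub>M {1..n} D)"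
      by (rule measurable_compose[OF 2]) simp
    show "(\<lambda>z. ennreal (std_normal_density (fst z j)) * ennreal (exp (X (snd z) j / sqrt 2 * ((fst z j - 0) / 1))))
      \<in> borel_measurable (P \<Otimes>\<^sub>M Pi\<^sub>M {1..n} D)"
      using 1 2 3 by measurable
  qed
  have lin: "ennreal (exp ((\<Sum>j=1..s. (X Y j)\<^sup>2) / 4)) = (\<integral>\<^sup>+\<xi>. H \<xi> Y \<partial>P)" for Y
  proof -
    have "(\<integral>\<^sup>+\<xi>. H \<xi> Y \<partial>P) = (\<Prod>j=1..s. \<integral>\<^sup>+y. ennreal (std_normal_density y) * ennreal (exp (X Y j / sqrt 2 * ((y - 0) / 1))) \<partial>lborel)"
      unfolding H_def P_def by (rule nn_integral_PiM_lborel_prod) measurable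
    also have "\<dots> = (\<Prod>j=1..s. ennreal (exp ((X Y j / sqrt 2)\<^sup>2 / 2)))"
      by (intro prod.cong refl nn_integral_normal_exp_linear) simp
    also have "\<dots> = ennreal (\<Prod>j=1..s. exp ((X Y j)\<^sup>2 / 4))"
      by (subst prod_ennreal) (simp_all add: power_divide)
    also have "\<dots> = ennreal (exp ((\<Sum>j=1..s. (X Y j)\<^sup>2) / 4))"
      by (simp add: exp_sum[symmetric] sum_divide_distrib)
    finally show ?thesis ..
  qed
  have inner: "(\<integral>\<^sup>+Y. H \<xi> Y \<partial>Pi\<^sub>M {1..n} D)
      = (\<Prod>j=1..s. ennreal (std_normal_density (\<xi> j)) * ennreal (exp (1 / 4 * (\<xi> j - 0)\<^sup>2 / 1\<^sup>2)))" for \<xi>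
  proof -
    \<comment> \<open>For fixed \<open>\<xi>\<close> the exponent is linear in the noise; these
      coefficients make its vector \<open>c\<close> a combination of the columns, so Pythagoras for
      the zero vector gives its squared length.\<close>
    define \<theta> where "\<theta> j = \<xi> j / sqrt 2 / sqrt (col_sq n j)" for j
    define c where "c i = (\<Sum>j=1..s. \<theta> j * fourier j (design n i))" for i
    have "(\<Sum>i=1..n. (0 - c i)\<^sup>2) = (\<Sum>j=1..s. (sqrt (col_sq n j) * \<theta> j)\<^sup>2)"
      using design_pythagoras[OF assms(2), of "\<lambda>_. 0" \<theta>] by (simp add: resid_def coord_def c_def)
    also have "\<dots> = (\<Sum>j=1..s. (\<xi> j)\<^sup>2 / 2)"
    proof (intro sum.cong refl)
      fix j assume "j \<in> {1..s}"
      then have "col_sq n j > 0" using col_sq_pos[of j n] assms by simp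
      then have "sqrt (col_sq n j) * \<theta> j = \<xi> j / sqrt 2" by (simp add: \<theta>_def)
      then show "(sqrt (col_sq n j) * \<theta> j)\<^sup>2 = (\<xi> j)\<^sup>2 / 2" by (simp add: power_divide)
    qed
    finally have csq: "(\<Sum>i=1..n. (c i)\<^sup>2) = (\<Sum>j=1..s. (\<xi> j)\<^sup>2 / 2)" by simp
    have swap: "(\<Sum>j=1..s. X Y j / sqrt 2 * ((\<xi> j - 0) / 1)) = (\<Sum>i=1..n. c i * ((Y i - f (design n i)) / \<sigma>))" for Y
    proof -
      have "(\<Sum>j=1..s. X Y j / sqrt 2 * ((\<xi> j - 0) / 1)) = (\<Sum>j=1..s. \<Sum>i=1..n. \<theta> j * fourier j (design n i) * ((Y i - f (design n i)) / \<sigma>))"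
        unfolding X_def coord_def \<theta>_def sum_divide_distrib sum_distrib_right
        by (intro sum.cong refl) (simp add: mult_ac)
      also have "\<dots> = (\<Sum>i=1..n. c i * ((Y i - f (design n i)) / \<sigma>))"
        unfolding c_def sum_distrib_right by (rule sum.swap)
      finally show ?thesis .
    qed
    have "H \<xi> Y = (\<Prod>j=1..s. ennreal (std_normal_density (\<xi> j))) * (\<Prod>i\<in>{1..n}. ennreal (exp (c i * ((Y i - f (design n i)) / \<sigma>))))" for Y
    proof -
      have "(\<Prod>j=1..s. ennreal (exp (X Y j / sqrt 2 * ((\<xi> j - 0) / 1)))) = (\<Prod>i\<in>{1..n}. ennreal (exp (c i * ((Y i - f (design n i)) / \<sigma>))))"
        by (subst (1 2) prod_ennreal, simp, simp, subst (1 2) exp_sum[symmetric], simp, simp, subst swap, rule refl)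
      then show ?thesis unfolding H_def prod.distrib by simp
    qed
    then have "(\<integral>\<^sup>+Y. H \<xi> Y \<partial>Pi\<^sub>M {1..n} D)
       = (\<integral>\<^sup>+Y. (\<Prod>j=1..s. ennreal (std_normal_density (\<xi> j))) * (\<Prod>i\<in>{1..n}. ennreal (exp (c i * ((Y i - f (design n i)) / \<sigma>)))) \<partial>Pi\<^sub>M {1..n} D)"
      by simp
    also have "\<dots> = (\<Prod>j=1..s. ennreal (std_normal_density (\<xi> j))) * (\<integral>\<^sup>+Y. (\<Prod>i\<in>{1..n}. ennreal (exp (c i * ((Y i - f (design n i)) / \<sigma>)))) \<partial>Pi\<^sub>M {1..n} D)"
    proof (rule nn_integral_cmult, rule borel_measurable_prod_ennreal)
      fix i assume "i \<in> {1..n}"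
      then have "(\<lambda>Y. Y i) \<in> measurable (Pi\<^sub>M {1..n} D) (D i)" by (rule measurable_component_singleton)
      then have "(\<lambda>Y. Y i) \<in> borel_measurable (Pi\<^sub>M {1..n} D)" by (simp add: D_def)
      then show "(\<lambda>Y. ennreal (exp (c i * ((Y i - f (design n i)) / \<sigma>)))) \<in> borel_measurable (Pi\<^sub>M {1..n} D)"
        by measurable
    qed
    also have "(\<integral>\<^sup>+Y. (\<Prod>i\<in>{1..n}. ennreal (exp (c i * ((Y i - f (design n i)) / \<sigma>)))) \<partial>Pi\<^sub>M {1..n} D)
       = (\<Prod>i\<in>{1..n}. \<integral>\<^sup>+y. ennreal (exp (c i * ((y - f (design n i)) / \<sigma>))) \<partial>D i)"
      by (rule DD.product_nn_integral_prod) (auto simp: D_def)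
    also have "\<dots> = (\<Prod>i\<in>{1..n}. ennreal (exp ((c i)\<^sup>2 / 2)))"
      unfolding D_def using nn_integral_normal_exp_linear[OF assms(1)]
      by (intro prod.cong refl) (subst nn_integral_density; simp)
    also have "\<dots> = ennreal (exp (\<Sum>i=1..n. (c i)\<^sup>2 / 2))"
      by (subst prod_ennreal) (simp_all add: exp_sum)
    also have "\<dots> = (\<Prod>j=1..s. ennreal (exp (1 / 4 * (\<xi> j - 0)\<^sup>2 / 1\<^sup>2)))"
      unfolding sum_divide_distrib[symmetric] csq
      by (subst prod_ennreal) (simp_all add: exp_sum[symmetric] sum_divide_distrib)
    finally show ?thesis by (simp add: prod.distrib)
  qed
  have "(\<integral>\<^sup>+Y. ennreal (exp ((\<Sum>j=1..s. (X Y j)\<^sup>2) / 4)) \<partial>Pi\<^sub>M {1..n} D) = (\<integral>\<^sup>+Y. (\<integral>\<^sup>+\<xi>. H \<xi> Y \<partial>P) \<partial>Pi\<^sub>M {1..n} D)"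
    unfolding lin ..
  also have "\<dots> = (\<integral>\<^sup>+\<xi>. (\<integral>\<^sup>+Y. H \<xi> Y \<partial>Pi\<^sub>M {1..n} D) \<partial>P)"
    using PD.Fubini'[OF mH] by simp
  also have "\<dots> = (\<integral>\<^sup>+\<xi>. (\<Prod>j=1..s. ennreal (std_normal_density (\<xi> j)) * ennreal (exp (1 / 4 * (\<xi> j - 0)\<^sup>2 / 1\<^sup>2))) \<partial>P)"
    unfolding inner ..
  also have "\<dots> = (\<Prod>j=1..s. \<integral>\<^sup>+y. ennreal (std_normal_density y) * ennreal (exp (1 / 4 * (y - 0)\<^sup>2 / 1\<^sup>2)) \<partial>lborel)"
    unfolding P_def by (rule nn_integral_PiM_lborel_prod) measurable
  \<comment> \<open>The two linearizations reproduce \<open>exp (\<xi>\<^sup>2 / 4)\<close> in each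
    coordinate, hence the tilt 1/4 and the factor \<open>sqrt 2\<close>.\<close>
  also have "\<dots> = (\<Prod>j=1..s. ennreal (1 / sqrt (1 - 2 * (1 / 4))))"
    by (intro prod.cong refl nn_integral_normal_exp_square) simp_all
  also have "\<dots> = ennreal (sqrt 2 ^ s)"
    by (simp add: real_sqrt_divide ennreal_power)
  finally show ?thesis unfolding X_def dl .
qed

section \<open>Deterministic bound for the posterior under small noise\<close>

lemma sum_exp_neg_le: "(\<Sum>s=m..n. exp (- real s)) \<le> 2 * exp (- real m)"
proof -
  \<comment> \<open>Subtracting the remaining tail makes the induction go through; its step amounts
    to \<open>2 \<le> exp 1\<close>.\<close>
  have "(\<Sum>s=m..<m+k. exp (- real s)) \<le> 2 * exp (- real m) - 2 * exp (- real (m + k))" for k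
  proof (induction k)
    case (Suc k)
    have "2 \<le> exp (1::real)" using exp_ge_add_one_self[of 1] by simp
    then have "2 * exp (- real (m + Suc k)) \<le> exp 1 * exp (- real (m + Suc k))"
      by (rule mult_right_mono) simp
    also have "\<dots> = exp (- real (m + k))" by (simp add: exp_add[symmetric])
    finally show ?case using Suc by simp
  qed simp
  from this[of "Suc n - m"] have "(\<Sum>s=m..<m+(Suc n - m). exp (- real s)) \<le> 2 * exp (- real m)"
    by (smt (verit) exp_ge_zero)
  moreover have "{m..n} \<subseteq> {m..<m+(Suc n - m)}" by auto
  ultimately show ?thesis
    by (meson exp_ge_zero finite_atLeastLessThan order_trans sum_mono2)
qed

lemma sqrt_2_power_le: "sqrt 2 ^ s \<le> exp (real s)"
proof -
  have "sqrt 2 \<le> sqrt (2\<^sup>2)" by (rule real_sqrt_le_mono) simp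
  also have "\<dots> = 2" by simp
  also have "\<dots> \<le> exp 1" using exp_ge_add_one_self[of 1] by simp
  finally have "sqrt 2 ^ s \<le> exp 1 ^ s" by (rule power_mono) simp
  then show ?thesis by (simp add: exp_of_nat_mult[symmetric])
qed

lemma coord_decompose:
  assumes "\<sigma> \<noteq> 0"
  shows "coord n Y j = coord n v j + \<sigma> * coord n (\<lambda>i. (Y i - v i) / \<sigma>) j"
proof -
  have "(\<Sum>i=1..n. fourier j (design n i) * Y i) = (\<Sum>i=1..n. fourier j (design n i) * v i)
      + \<sigma> * (\<Sum>i=1..n. fourier j (design n i) * ((Y i - v i) / \<sigma>))"
    unfolding sum_distrib_left sum.distrib[symmetric] using assms
    by (intro sum.cong refl) (simp add: field_simps)
  then show ?thesis unfolding coord_def by (simp add: add_divide_distrib)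
qed

text \<open>
  Here \<open>r\<close> stands for \<open>n\<close> times the squared rate; \<open>S\<close> is a small multiple of \<open>r\<close> and \<open>m\<close> a fixed multiple
  of \<open>S\<close>. A size \<open>s > m\<close> is ruled out by the penalty, and a size with bias above \<open>r / 8\<close> by comparison with
  the size \<open>S\<close>, whose bias is negligible; for the remaining sizes the conditional posterior
  puts little mass far from the least-squares estimator.
\<close>

lemma posterior_le:
  fixes \<sigma> \<gamma> \<alpha> r G :: real and v Y :: "nat \<Rightarrow> real" and n S m :: nat
  defines "lk \<equiv> 1 / (2 * \<gamma> * \<sigma>\<^sup>2)"
  defines "noise \<equiv> \<lambda>s. \<Sum>j=1..s. (coord n (\<lambda>i. (Y i - v i) / \<sigma>) j)\<^sup>2"
  assumes pos: "\<sigma> > 0" "\<gamma> > 0" "0 < \<alpha>" "\<alpha> < 1"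
    and S: "1 \<le> S" "S \<le> m" "m \<le> n"
    and Prior: "Prior \<in> {type1_prior \<sigma> \<gamma> g \<alpha>, type2_prior \<sigma> \<gamma> g \<alpha>}"
    and A: "A \<in> sets seq_space"
    and far: "\<And>s x. s \<in> {1..n} \<Longrightarrow> pad s x \<in> A \<Longrightarrow>
      r < (\<Sum>i=1..n. (v i - (\<Sum>j=1..s. x j * fourier j (design n i)))\<^sup>2)"
    and G: "\<And>s. 1 \<le> s \<Longrightarrow> \<bar>g (real s)\<bar> \<le> G" and g10: "\<And>s. m < s \<Longrightarrow> 10 \<le> g (real s)"
    and bias: "resid n v S \<le> real S"
    and noise: "\<And>s. s \<in> {S..n} \<Longrightarrow> noise s \<le> 8 * real s"
    and h: "(8 + 128 * \<sigma>\<^sup>2) * real m \<le> r" "(1 + lk) * real m \<le> \<gamma> * r / 32"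
      "(1 / 2 + 8 * \<sigma>\<^sup>2) * real m \<le> r / 32" "(2 * G + lk) * real m \<le> \<alpha> * r / (128 * \<sigma>\<^sup>2)"
      "(G + lk + 1 / \<sigma>\<^sup>2) * real S \<le> real m"
  shows "posterior \<sigma> n Y (Prior n Y) A
    \<le> ennreal (real m * exp (- min (\<gamma> / 32) (\<alpha> / (128 * \<sigma>\<^sup>2)) * r) + 2 * exp (- real m))"
proof -
  define c where "c = min (\<gamma> / 32) (\<alpha> / (128 * \<sigma>\<^sup>2))"
  have n1: "n \<ge> 1" using S by simp
  have lk0: "lk \<ge> 0" using pos by (simp add: lk_def)
  have G0: "G \<ge> 0" using G[of 1] by simp
  have Sn: "S \<in> {1..n}" using S by simp
  have m0: "real m > 0" using S by simp
  have r0: "r > 0"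
  proof -
    have "0 < (8 + 128 * \<sigma>\<^sup>2) * real m" using m0 by (intro mult_pos_pos add_pos_nonneg) auto
    then show ?thesis using h(1) by linarith
  qed
  have h8: "8 * real m \<le> r" "128 * \<sigma>\<^sup>2 * real m \<le> r"
  proof -
    have "0 \<le> 128 * \<sigma>\<^sup>2 * real m" by simp
    then show "8 * real m \<le> r" "128 * \<sigma>\<^sup>2 * real m \<le> r"
      using h(1) m0 unfolding distrib_right by linarith+
  qed
  obtain a where a: "0 \<le> a" "a \<le> 1 / (2 * \<sigma>\<^sup>2)"
    and post: "posterior \<sigma> n Y (Prior n Y) A
      = (\<Sum>s=1..n. ennreal (post_weight \<sigma> g \<alpha> n Y s) * cond_mass \<gamma> n Y a s A)
        / (\<Sum>s=1..n. ennreal (post_weight \<sigma> g \<alpha> n Y s) * cond_mass \<gamma> n Y a s UNIV)"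
    using posterior_eq[OF pos(1,2) n1 pos(3,4) Prior A] by blast
  define W where "W s = post_weight \<sigma> g \<alpha> n Y s" for s
  define Den where "Den = (\<Sum>s=1..n. ennreal (W s) * cond_mass \<gamma> n Y a s UNIV)"
  have Wpos: "W s > 0" for s by (simp add: W_def post_weight_def)
  \<comment> \<open>\<open>exp (- lk)\<close> bounds the normalising constant per coordinate from
    below for both types, by \<open>sqrt (1 + 2 * y) \<le> exp y\<close> and the upper bound on
    \<open>a\<close>.\<close>
  have kappa: "exp (- lk * real s) \<le> (1 / sqrt (1 + 2 * (a / \<gamma>))) ^ s" for s
  proof -
    have "1 + 2 * (a / \<gamma>) \<le> exp (2 * (a / \<gamma>))" by simp
    also have "\<dots> \<le> exp (2 * lk)"
    proof -
      have "a / \<gamma> \<le> 1 / (2 * \<sigma>\<^sup>2) / \<gamma>" using a pos by (intro divide_right_mono) auto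
      also have "\<dots> = lk" by (simp add: lk_def mult_ac)
      finally show ?thesis unfolding exp_le_cancel_iff by linarith
    qed
    finally have "sqrt (1 + 2 * (a / \<gamma>)) \<le> sqrt (exp (2 * lk))" by (rule real_sqrt_le_mono)
    also have "\<dots> = exp lk" by (rule real_sqrt_unique) (auto simp: power2_eq_square exp_add[symmetric])
    finally have le: "sqrt (1 + 2 * (a / \<gamma>)) \<le> exp lk" .
    have p: "sqrt (1 + 2 * (a / \<gamma>)) > 0" using a pos by (simp add: add_pos_nonneg)
    have "exp (- lk) \<le> 1 / sqrt (1 + 2 * (a / \<gamma>))"
      unfolding exp_minus inverse_eq_divide using le p by (intro divide_left_mono) auto
    then have "exp (- lk) ^ s \<le> (1 / sqrt (1 + 2 * (a / \<gamma>))) ^ s" by (rule power_mono) simp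
    then show ?thesis by (simp add: exp_of_nat_mult[symmetric] mult.commute)
  qed
  have Den_ge: "ennreal (W t * exp (- lk * real t)) \<le> Den" if t: "t \<in> {1..n}" for t
  proof -
    have "ennreal (W t * exp (- lk * real t)) \<le> ennreal (W t) * cond_mass \<gamma> n Y a t UNIV"
      using t pos a kappa[of t] Wpos[of t]
      by (simp add: cond_mass_UNIV ennreal_mult[symmetric] mult_left_mono ennreal_leI less_imp_le del: mult_minus_left)
    also have "\<dots> \<le> Den" unfolding Den_def using t by (intro member_le_sum) auto
    finally show ?thesis .
  qed
  have Den_pos: "Den > 0" using Den_ge[OF Sn] Wpos[of S] by (metis ennreal_less_zero_iff exp_gt_zero less_le_trans mult_pos_pos)
  \<comment> \<open>\<open>t\<close> is the size whose term alone bounds \<open>Den\<close> from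
    below: \<open>s\<close> itself if \<open>s \<le> m\<close> has small bias, and \<open>S\<close>
    in the other cases.\<close>
  have term_le: "ennreal (W s) * cond_mass \<gamma> n Y a s A / Den \<le> ennreal z"
    if "cond_mass \<gamma> n Y a s A \<le> ennreal p" "t \<in> {1..n}" "W s * p \<le> W t * exp (- lk * real t) * z" "z \<ge> 0" "p \<ge> 0"
    for s t p z
  proof (rule divide_le_posI_ennreal[OF Den_pos])
    have "ennreal (W s) * cond_mass \<gamma> n Y a s A \<le> ennreal (W s) * ennreal p"
      using that(1) by (intro mult_left_mono) auto
    also have "\<dots> \<le> ennreal (W t * exp (- lk * real t)) * ennreal z"
      using that Wpos[of s] Wpos[of t] by (simp add: ennreal_mult[symmetric] ennreal_leI less_imp_le del: mult_minus_left)
    also have "\<dots> \<le> Den * ennreal z" using Den_ge[OF that(2)] by (intro mult_right_mono) auto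
    finally show "ennreal (W s) * cond_mass \<gamma> n Y a s A \<le> Den * ennreal z" .
  qed
  have noise_mono: "noise s \<le> noise t" if "s \<le> t" for s t
    unfolding noise_def using that by (intro sum_mono2) auto
  have noise_m: "noise s \<le> 8 * real m" if "s \<le> m" for s
    using noise_mono[OF that] noise[of m] S by simp
  have sigma_noise_m: "\<sigma>\<^sup>2 * noise s \<le> \<sigma>\<^sup>2 * (8 * real m)" if "s \<le> m" for s
    using noise_m[OF that] by (rule mult_left_mono) simp
  have sigma_noise: "\<sigma>\<^sup>2 * noise s \<le> \<sigma>\<^sup>2 * (8 * real s)" if "s \<in> {S..n}" for s
    using noise[OF that] by (rule mult_left_mono) simp
  have cY: "coord n Y j = coord n v j + \<sigma> * coord n (\<lambda>i. (Y i - v i) / \<sigma>) j" for j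
    using pos by (intro coord_decompose) simp
  have sub_noise: "(\<Sum>j=Suc s..t. (\<sigma> * coord n (\<lambda>i. (Y i - v i) / \<sigma>) j)\<^sup>2) \<le> \<sigma>\<^sup>2 * noise t" for s t
    unfolding noise_def sum_distrib_left power_mult_distrib by (intro sum_mono2) auto
  have ratio: "W s \<le> W S * exp e" if "- g (real s) * real s + g (real S) * real S
      + \<alpha> * (resid n Y S - resid n Y s) / (2 * \<sigma>\<^sup>2) \<le> e" for s e
    using that unfolding W_def post_weight_def exp_add[symmetric] by (simp add: diff_divide_distrib right_diff_distrib)
  have gS: "g (real S) * real S \<le> G * real S" using G[OF S(1)] by (intro mult_right_mono) auto
  have c0: "c * r \<le> \<gamma> * r / 32" "c * r \<le> \<alpha> * r / (128 * \<sigma>\<^sup>2)"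
  proof -
    have "c * r \<le> \<gamma> / 32 * r" "c * r \<le> \<alpha> / (128 * \<sigma>\<^sup>2) * r"
      unfolding c_def using r0 by (intro mult_right_mono; simp)+
    then show "c * r \<le> \<gamma> * r / 32" "c * r \<le> \<alpha> * r / (128 * \<sigma>\<^sup>2)" by simp_all
  qed
  have small: "ennreal (W s) * cond_mass \<gamma> n Y a s A / Den \<le> ennreal (exp (- c * r))"
    if s: "s \<in> {1..m}" for s
  proof -
    have sn: "s \<in> {1..n}" "s \<le> n" using s S by auto
    have sm': "s \<le> m" using s by simp
    then have sm: "real s \<le> real m" by simp
    show ?thesis
    proof (cases "resid n v s \<le> r / 8")
      case True
      \<comment> \<open>Loss above \<open>r\<close> with bias at most \<open>r / 8\<close> forces
        distance from the estimator: the noise takes at most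
        \<open>16 * \<sigma>\<^sup>2 * m \<le> r / 8\<close>, leaving \<open>2 * qform\<close> above
        \<open>3 * r / 4\<close>.\<close>
      have q: "r / 4 \<le> qform n Y s x" if "pad s x \<in> A" for x
      proof -
        have "r < resid n v s + (\<Sum>j=1..s. (sqrt (col_sq n j) * x j - coord n v j)\<^sup>2)"
          using far[OF sn(1) that] unfolding design_pythagoras[OF sn(2)] .
        also have "(\<Sum>j=1..s. (sqrt (col_sq n j) * x j - coord n v j)\<^sup>2)
          \<le> (\<Sum>j=1..s. 2 * (sqrt (col_sq n j) * x j - coord n Y j)\<^sup>2 + 2 * (\<sigma> * coord n (\<lambda>i. (Y i - v i) / \<sigma>) j)\<^sup>2)"
        proof (intro sum_mono)
          fix j
          show "(sqrt (col_sq n j) * x j - coord n v j)\<^sup>2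
            \<le> 2 * (sqrt (col_sq n j) * x j - coord n Y j)\<^sup>2 + 2 * (\<sigma> * coord n (\<lambda>i. (Y i - v i) / \<sigma>) j)\<^sup>2"
            using sq_add_le[of "sqrt (col_sq n j) * x j - coord n Y j" "\<sigma> * coord n (\<lambda>i. (Y i - v i) / \<sigma>) j"]
            unfolding cY by simp
        qed
        also have "\<dots> = 2 * qform n Y s x + 2 * (\<Sum>j=Suc 0..s. (\<sigma> * coord n (\<lambda>i. (Y i - v i) / \<sigma>) j)\<^sup>2)"
          unfolding qform_eq[OF sn(2)] by (simp add: sum.distrib sum_distrib_left)
        also have "\<dots> \<le> 2 * qform n Y s x + 2 * (\<sigma>\<^sup>2 * (8 * real m))"
          using sub_noise[of 0 s] sigma_noise_m[OF sm'] by (intro add_mono mult_left_mono; linarith)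
        finally show ?thesis using True h8 by simp
      qed
      show ?thesis
      proof (rule term_le[OF _ sn(1)])
        show "cond_mass \<gamma> n Y a s A \<le> ennreal (sqrt 2 ^ s * exp (- \<gamma> / 4 * (r / 4)))"
          using sn(2) pos(2) a(1) q by (rule cond_mass_tail_le)
        have "sqrt 2 ^ s \<le> exp (real s)" by (rule sqrt_2_power_le)
        then have "sqrt 2 ^ s * exp (- \<gamma> / 4 * (r / 4)) \<le> exp (real s) * exp (- \<gamma> / 4 * (r / 4))"
          by (rule mult_right_mono) simp
        \<comment> \<open>Of the exponent \<open>\<gamma> * r / 16\<close> one half pays for
          \<open>(1 + lk) * s\<close>; the other half is at least \<open>c * r\<close>.\<close>
        also have "\<dots> \<le> exp (- lk * real s + - c * r)"
        proof -
          have "(1 + lk) * real s \<le> \<gamma> * r / 32"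
            using mult_left_mono[OF sm, of "1 + lk"] lk0 h(2) by linarith
          then show ?thesis unfolding exp_add[symmetric] using c0(1) by (simp add: distrib_right)
        qed
        finally show "W s * (sqrt 2 ^ s * exp (- \<gamma> / 4 * (r / 4))) \<le> W s * exp (- lk * real s) * exp (- c * r)"
          unfolding exp_add mult.assoc using Wpos[of s] by (intro mult_left_mono) auto
      qed auto
    next
      case False
      \<comment> \<open>The bias decreases in the size and is already at most \<open>r / 8\<close>
        at \<open>S\<close>, so a large bias occurs only below \<open>S\<close>.\<close>
      have sS: "s < S"
      proof (rule ccontr)
        assume "\<not> s < S"
        then have "resid n v s \<le> resid n v S" using resid_diff[of S s n v]
          by (smt (verit) not_less sum_nonneg zero_le_power2)
        also have "\<dots> \<le> r / 8" using bias S h8(1) by simp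
        finally show False using False by simp
      qed
      show ?thesis
      proof (rule term_le[OF _ Sn])
        show "cond_mass \<gamma> n Y a s A \<le> ennreal 1" using cond_mass_le_1[OF sn(2) pos(2) a(1)] by simp
        \<comment> \<open>The bias missing at \<open>s\<close> must appear in the data coordinates
          between \<open>s\<close> and \<open>S\<close>. Solving for the gap gives
          \<open>r / 16 - (1 / 2 + 8 * \<sigma>\<^sup>2) * m\<close>, at least
          \<open>r / 32\<close>.\<close>
        have "r / 8 - real m \<le> resid n v s - resid n v S" using False bias S by simp
        also have "\<dots> = (\<Sum>j=Suc s..S. (coord n v j)\<^sup>2)" using sS by (intro resid_diff) simp
        also have "\<dots> \<le> (\<Sum>j=Suc s..S. 2 * (coord n Y j)\<^sup>2 + 2 * (\<sigma> * coord n (\<lambda>i. (Y i - v i) / \<sigma>) j)\<^sup>2)"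
        proof (intro sum_mono)
          fix j
          show "(coord n v j)\<^sup>2 \<le> 2 * (coord n Y j)\<^sup>2 + 2 * (\<sigma> * coord n (\<lambda>i. (Y i - v i) / \<sigma>) j)\<^sup>2"
            using sq_add_le[of "coord n Y j" "- (\<sigma> * coord n (\<lambda>i. (Y i - v i) / \<sigma>) j)"] unfolding cY[of j] by simp
        qed
        also have "\<dots> = 2 * (resid n Y s - resid n Y S) + 2 * (\<Sum>j=Suc s..S. (\<sigma> * coord n (\<lambda>i. (Y i - v i) / \<sigma>) j)\<^sup>2)"
          using sS resid_diff[of s S n Y] by (simp add: sum.distrib sum_distrib_left)
        also have "\<dots> \<le> 2 * (resid n Y s - resid n Y S) + 2 * (\<sigma>\<^sup>2 * (8 * real m))"
          using sub_noise[of s S] sigma_noise_m[OF S(2)] by (intro add_mono mult_left_mono; linarith)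
        finally have gap: "r / 32 \<le> resid n Y s - resid n Y S" using h(3) by (simp add: algebra_simps)
        have "\<alpha> * (resid n Y S - resid n Y s) / (2 * \<sigma>\<^sup>2) \<le> \<alpha> * (- (r / 32)) / (2 * \<sigma>\<^sup>2)"
          using gap pos by (intro divide_right_mono mult_left_mono) auto
        moreover have "- g (real s) * real s \<le> G * real m"
        proof -
          have "- g (real s) * real s \<le> G * real s" using G[of s] s by (intro mult_right_mono) auto
          also have "\<dots> \<le> G * real m" using sm G0 by (rule mult_left_mono)
          finally show ?thesis .
        qed
        moreover have "g (real S) * real S \<le> G * real m"
        proof -
          have "G * real S \<le> G * real m" using S(2) G0 by (intro mult_left_mono) auto
          then show ?thesis using gS by linarith
        qed
        moreover have "lk * real S \<le> lk * real m" using S(2) lk0 by (intro mult_left_mono) auto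
        \<comment> \<open>One half of the gain pays for the two penalties and \<open>lk * m\<close>,
          the other half gives the decay.\<close>
        moreover have "\<alpha> * (- (r / 32)) / (2 * \<sigma>\<^sup>2) = - 2 * (\<alpha> * r / (128 * \<sigma>\<^sup>2))" by simp
        ultimately have "W s \<le> W S * exp (- lk * real S + - c * r)"
          using h(4) c0(2) by (intro ratio) (simp add: distrib_right)
        then show "W s * 1 \<le> W S * exp (- lk * real S) * exp (- c * r)" by (simp only: exp_add mult.assoc mult_1_right)
      qed auto
    qed
  qed
  have large: "ennreal (W s) * cond_mass \<gamma> n Y a s A / Den \<le> ennreal (exp (- real s))"
    if s: "s \<in> {Suc m..n}" for s
  proof -
    have sn: "s \<in> {1..n}" "s \<le> n" using s S by auto
    have Ss: "S \<le> s" and sS: "s \<in> {S..n}" using s S by auto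
    show ?thesis
    proof (rule term_le[OF _ Sn])
      show "cond_mass \<gamma> n Y a s A \<le> ennreal 1" using cond_mass_le_1[OF sn(2) pos(2) a(1)] by simp
      have "resid n Y S - resid n Y s = (\<Sum>j=Suc S..s. (coord n Y j)\<^sup>2)" using Ss by (rule resid_diff)
      also have "\<dots> \<le> (\<Sum>j=Suc S..s. 2 * (coord n v j)\<^sup>2 + 2 * (\<sigma> * coord n (\<lambda>i. (Y i - v i) / \<sigma>) j)\<^sup>2)"
        unfolding cY by (intro sum_mono sq_add_le)
      also have "\<dots> = 2 * (resid n v S - resid n v s) + 2 * (\<Sum>j=Suc S..s. (\<sigma> * coord n (\<lambda>i. (Y i - v i) / \<sigma>) j)\<^sup>2)"
        using resid_diff[OF Ss, of n v] by (simp add: sum.distrib sum_distrib_left)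
      also have "\<dots> \<le> 2 * real S + 2 * (\<sigma>\<^sup>2 * (8 * real s))"
        using sub_noise[of S s] sigma_noise[OF sS] bias resid_nonneg[OF sn(2), of v]
        by (intro add_mono mult_left_mono; linarith)
      finally have gap: "resid n Y S - resid n Y s \<le> 2 * real S + 2 * (\<sigma>\<^sup>2 * (8 * real s))" .
      \<comment> \<open>Replacing \<alpha> by 1 and cancelling \<open>\<sigma>\<^sup>2\<close>
        leaves \<open>8 * s\<close> for the noise, whatever \<alpha> and \<sigma> are.\<close>
      have "\<alpha> * (resid n Y S - resid n Y s) / (2 * \<sigma>\<^sup>2) \<le> 1 * (2 * real S + 2 * (\<sigma>\<^sup>2 * (8 * real s))) / (2 * \<sigma>\<^sup>2)"
      proof (intro divide_right_mono mult_mono)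
        show "0 \<le> resid n Y S - resid n Y s" unfolding resid_diff[OF Ss] by (simp add: sum_nonneg)
      qed (use gap pos in auto)
      also have "\<dots> = 1 / \<sigma>\<^sup>2 * real S + 8 * real s" using pos by (simp add: add_divide_distrib)
      finally have "\<alpha> * (resid n Y S - resid n Y s) / (2 * \<sigma>\<^sup>2) \<le> 1 / \<sigma>\<^sup>2 * real S + 8 * real s" .
      moreover have "- g (real s) * real s \<le> - 10 * real s"
        using g10[of s] s by (intro mult_right_mono) auto
      moreover have "real m \<le> real s" using s by simp
      moreover have "(G + lk + 1 / \<sigma>\<^sup>2) * real S = G * real S + lk * real S + 1 / \<sigma>\<^sup>2 * real S"
        by (simp add: distrib_right)
      \<comment> \<open>Of \<open>10 * s\<close>, eight units cancel the noise, one covers all terms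
        in \<open>S\<close> since their sum is at most \<open>m \<le> s\<close>, and one
        remains.\<close>
      ultimately have "W s \<le> W S * exp (- lk * real S + - real s)"
        using h(5) gS by (intro ratio) simp
      then show "W s * 1 \<le> W S * exp (- lk * real S) * exp (- real s)" by (simp only: exp_add mult.assoc mult_1_right)
    qed auto
  qed
  have "posterior \<sigma> n Y (Prior n Y) A = (\<Sum>s=1..n. ennreal (W s) * cond_mass \<gamma> n Y a s A / Den)"
    unfolding post W_def[symmetric] Den_def[symmetric] divide_ennreal_def sum_distrib_right ..
  also have "{1..n} = {1..m} \<union> {Suc m..n}" using S by auto
  also have "(\<Sum>s\<in>{1..m} \<union> {Suc m..n}. ennreal (W s) * cond_mass \<gamma> n Y a s A / Den)
     = (\<Sum>s=1..m. ennreal (W s) * cond_mass \<gamma> n Y a s A / Den) + (\<Sum>s=Suc m..n. ennreal (W s) * cond_mass \<gamma> n Y a s A / Den)"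
    by (rule sum.union_disjoint) auto
  also have "\<dots> \<le> (\<Sum>s=1..m. ennreal (exp (- c * r))) + (\<Sum>s=Suc m..n. ennreal (exp (- real s)))"
    by (intro add_mono sum_mono small large)
  also have "\<dots> = ennreal (real m * exp (- c * r) + (\<Sum>s=Suc m..n. exp (- real s)))"
    by (simp add: sum_ennreal sum_nonneg ennreal_of_nat_eq_real_of_nat ennreal_mult[symmetric] ennreal_plus[symmetric] del: ennreal_plus)
  also have "\<dots> \<le> ennreal (real m * exp (- c * r) + 2 * exp (- real m))"
  proof (intro ennreal_leI add_left_mono)
    have "(\<Sum>s=Suc m..n. exp (- real s)) \<le> (\<Sum>s=m..n. exp (- real s))" by (intro sum_mono2) auto
    then show "(\<Sum>s=Suc m..n. exp (- real s)) \<le> 2 * exp (- real m)" using sum_exp_neg_le[of m n] by linarith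
  qed
  finally show ?thesis unfolding c_def .
qed

section \<open>Contraction\<close>

text \<open>Degenerate denominators are covered by the conventions for \<open>ennreal\<close>:
  \<open>0 / 0 = 0\<close>, and division by infinity gives 0.\<close>

lemma posterior_le_1: "posterior \<sigma> n Y P A \<le> 1"
proof -
  let ?num = "\<integral>\<^sup>+\<theta>\<in>A. ennreal (likelihood \<sigma> n Y \<theta>) \<partial>P" and ?den = "\<integral>\<^sup>+\<theta>. ennreal (likelihood \<sigma> n Y \<theta>) \<partial>P"
  have le: "?num \<le> ?den" by (intro nn_integral_mono) (simp add: indicator_def)
  show ?thesis
  proof (cases "?den = 0 \<or> ?den = \<infinity>")
    case True
    then show ?thesis using le unfolding posterior_def by auto
  next
    case False
    then have "?num / ?den \<le> ?den / ?den" using le by (intro divide_right_mono_ennreal)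
    also have "\<dots> = 1" using False by (intro ennreal_divide_self) (auto simp: less_top)
    finally show ?thesis unfolding posterior_def .
  qed
qed

lemma prob_space_data_law:
  assumes "\<sigma> > 0"
  shows "prob_space (data_law \<sigma> n f)"
  unfolding data_law_def by (intro prob_space_PiM prob_space_normal_density assms)

text \<open>Markov bounds summed over the sizes: the \<open>s\<close>-th summand is at least 1 once
  the noise exceeds \<open>8 * s\<close>, and its expectation is at most
  \<open>exp (- s)\<close>.\<close>

lemma nn_integral_exp_noise_sum:
  assumes "\<sigma> > 0"
  shows "(\<integral>\<^sup>+Y. ennreal b + (\<Sum>s=S..n. ennreal (exp (- 2 * real s))
      * ennreal (exp ((\<Sum>j=1..s. (coord n (\<lambda>i. (Y i - f (design n i)) / \<sigma>) j)\<^sup>2) / 4))) \<partial>data_law \<sigma> n f)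
    \<le> ennreal b + ennreal (2 * exp (- real S))"
proof -
  let ?N = "\<lambda>s Y. (\<Sum>j=1..s. (coord n (\<lambda>i. (Y i - f (design n i)) / \<sigma>) j)\<^sup>2)"
  interpret prob_space "data_law \<sigma> n f" by (rule prob_space_data_law[OF assms])
  have mN: "(\<lambda>Y. ennreal (exp (?N s Y / 4))) \<in> borel_measurable (data_law \<sigma> n f)" for s
    using measurable_coord_noise[of n f \<sigma>] by measurable
  have "(\<integral>\<^sup>+Y. ennreal b + (\<Sum>s=S..n. ennreal (exp (- 2 * real s)) * ennreal (exp (?N s Y / 4))) \<partial>data_law \<sigma> n f)
    = (\<integral>\<^sup>+Y. ennreal b \<partial>data_law \<sigma> n f)
      + (\<integral>\<^sup>+Y. (\<Sum>s=S..n. ennreal (exp (- 2 * real s)) * ennreal (exp (?N s Y / 4))) \<partial>data_law \<sigma> n f)"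
    by (intro nn_integral_add borel_measurable_const borel_measurable_sum borel_measurable_times_ennreal mN)
  also have "(\<integral>\<^sup>+Y. ennreal b \<partial>data_law \<sigma> n f) = ennreal b" by (simp add: emeasure_space_1)
  also have "(\<integral>\<^sup>+Y. (\<Sum>s=S..n. ennreal (exp (- 2 * real s)) * ennreal (exp (?N s Y / 4))) \<partial>data_law \<sigma> n f)
    = (\<Sum>s=S..n. \<integral>\<^sup>+Y. ennreal (exp (- 2 * real s)) * ennreal (exp (?N s Y / 4)) \<partial>data_law \<sigma> n f)"
    by (intro nn_integral_sum borel_measurable_times_ennreal borel_measurable_const mN)
  also have "\<dots> \<le> (\<Sum>s=S..n. ennreal (exp (- real s)))"
  proof (intro sum_mono)
    fix s assume "s \<in> {S..n}"
    then have s: "s \<le> n" by simp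
    have "(\<integral>\<^sup>+Y. ennreal (exp (- 2 * real s)) * ennreal (exp (?N s Y / 4)) \<partial>data_law \<sigma> n f)
      = ennreal (exp (- 2 * real s)) * ennreal (sqrt 2 ^ s)"
      unfolding nn_integral_cmult[OF mN] nn_integral_exp_noise[OF assms s] ..
    also have "\<dots> = ennreal (exp (- 2 * real s) * sqrt 2 ^ s)" by (simp add: ennreal_mult)
    also have "\<dots> \<le> ennreal (exp (- 2 * real s) * exp (real s))"
      by (intro ennreal_leI mult_left_mono sqrt_2_power_le) simp
    also have "\<dots> = ennreal (exp (- real s))" by (simp add: exp_add[symmetric])
    finally show "(\<integral>\<^sup>+Y. ennreal (exp (- 2 * real s)) * ennreal (exp (?N s Y / 4)) \<partial>data_law \<sigma> n f) \<le> ennreal (exp (- real s))" .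
  qed
  also have "\<dots> = ennreal (\<Sum>s=S..n. exp (- real s))" by (rule sum_ennreal) simp
  also have "\<dots> \<le> ennreal (2 * exp (- real S))" by (intro ennreal_leI sum_exp_neg_le)
  finally show ?thesis by (simp add: add_left_mono)
qed

text \<open>A pointwise majorant, measurable in \<open>Y\<close>, replaces the split into a good
  event and its complement; of the integral of the posterior itself only monotonicity is
  used.\<close>

lemma expected_posterior_le:
  fixes \<sigma> \<gamma> \<alpha> r G :: real and f :: "real \<Rightarrow> real" and n S m :: nat
  defines "lk \<equiv> 1 / (2 * \<gamma> * \<sigma>\<^sup>2)"
  assumes pos: "\<sigma> > 0" "\<gamma> > 0" "0 < \<alpha>" "\<alpha> < 1"
    and S: "1 \<le> S" "S \<le> m" "m \<le> n"
    and Prior: "Prior \<in> {type1_prior \<sigma> \<gamma> g \<alpha>, type2_prior \<sigma> \<gamma> g \<alpha>}"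
    and A: "A \<in> sets seq_space"
    and far: "\<And>s x. s \<in> {1..n} \<Longrightarrow> pad s x \<in> A \<Longrightarrow>
      r < (\<Sum>i=1..n. (f (design n i) - (\<Sum>j=1..s. x j * fourier j (design n i)))\<^sup>2)"
    and G: "\<And>s. 1 \<le> s \<Longrightarrow> \<bar>g (real s)\<bar> \<le> G" and g10: "\<And>s. m < s \<Longrightarrow> 10 \<le> g (real s)"
    and bias: "resid n (\<lambda>i. f (design n i)) S \<le> real S"
    and h: "(8 + 128 * \<sigma>\<^sup>2) * real m \<le> r" "(1 + lk) * real m \<le> \<gamma> * r / 32"
      "(1 / 2 + 8 * \<sigma>\<^sup>2) * real m \<le> r / 32" "(2 * G + lk) * real m \<le> \<alpha> * r / (128 * \<sigma>\<^sup>2)"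
      "(G + lk + 1 / \<sigma>\<^sup>2) * real S \<le> real m"
  shows "(\<integral>\<^sup>+Y. posterior \<sigma> n Y (Prior n Y) A \<partial>data_law \<sigma> n f)
    \<le> ennreal (real m * exp (- min (\<gamma> / 32) (\<alpha> / (128 * \<sigma>\<^sup>2)) * r) + 4 * exp (- real S))"
proof -
  define b where "b = real m * exp (- min (\<gamma> / 32) (\<alpha> / (128 * \<sigma>\<^sup>2)) * r) + 2 * exp (- real m)"
  let ?N = "\<lambda>s Y. (\<Sum>j=1..s. (coord n (\<lambda>i. (Y i - f (design n i)) / \<sigma>) j)\<^sup>2)"
  have "(\<integral>\<^sup>+Y. posterior \<sigma> n Y (Prior n Y) A \<partial>data_law \<sigma> n f)
    \<le> (\<integral>\<^sup>+Y. ennreal b + (\<Sum>s=S..n. ennreal (exp (- 2 * real s)) * ennreal (exp (?N s Y / 4))) \<partial>data_law \<sigma> n f)"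
  proof (intro nn_integral_mono)
    fix Y :: "nat \<Rightarrow> real"
    show "posterior \<sigma> n Y (Prior n Y) A \<le> ennreal b + (\<Sum>s=S..n. ennreal (exp (- 2 * real s)) * ennreal (exp (?N s Y / 4)))"
    proof (cases "\<forall>s\<in>{S..n}. ?N s Y \<le> 8 * real s")
      case True
      have "posterior \<sigma> n Y (Prior n Y) A \<le> ennreal b"
        unfolding b_def
        by (rule posterior_le[OF pos S Prior A far G g10 bias _ h[unfolded lk_def]]) (use True in auto)
      then show ?thesis by (rule order_trans) simp
    next
      case False
      then obtain s where s: "s \<in> {S..n}" "8 * real s < ?N s Y" by force
      have "posterior \<sigma> n Y (Prior n Y) A \<le> ennreal 1" using posterior_le_1 by simp
      also have "\<dots> \<le> ennreal (exp (- 2 * real s + ?N s Y / 4))" using s(2) by (intro ennreal_leI) simp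
      also have "\<dots> = ennreal (exp (- 2 * real s)) * ennreal (exp (?N s Y / 4))"
        unfolding exp_add by (rule ennreal_mult) simp_all
      also have "\<dots> \<le> (\<Sum>s=S..n. ennreal (exp (- 2 * real s)) * ennreal (exp (?N s Y / 4)))"
        using s(1) by (intro member_le_sum) auto
      also have "\<dots> \<le> ennreal b + \<dots>" by simp
      finally show ?thesis .
    qed
  qed
  also have "\<dots> \<le> ennreal b + ennreal (2 * exp (- real S))" by (rule nn_integral_exp_noise_sum[OF pos(1)])
  also have "\<dots> = ennreal (b + 2 * exp (- real S))" by (simp add: b_def)
  also have "\<dots> \<le> ennreal (real m * exp (- min (\<gamma> / 32) (\<alpha> / (128 * \<sigma>\<^sup>2)) * r) + 4 * exp (- real S))"
    using S(2) unfolding b_def by (intro ennreal_leI) simp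
  finally show ?thesis .
qed

theorem proposition5:
  fixes \<sigma> \<gamma> :: real
  assumes "\<sigma> > 0" and "0 < \<gamma>" and "\<gamma> < 1"
  shows "\<exists>B>0. \<forall>g :: real \<Rightarrow> real.
           mono_on {1..} g \<and> slowly_varying g \<and> bdd_above (g ` {1..}) \<and>
           (\<forall>\<^sub>F x in at_top. B \<le> g x) \<longrightarrow>
           (\<forall>\<beta>>1/2. \<forall>\<theta>star \<in> sobolev \<beta>. \<exists>M>0. \<forall>\<alpha>. 0 < \<alpha> \<and> \<alpha> < 1 \<longrightarrow>
             (\<forall>Prior \<in> {type1_prior \<sigma> \<gamma> g \<alpha>, type2_prior \<sigma> \<gamma> g \<alpha>}.
               ((\<lambda>n. \<integral>\<^sup>+ Y. posterior \<sigma> n Y (Prior n Y)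
                       {\<theta>. emp_norm n (\<lambda>t. fseries \<theta> t - fseries \<theta>star t)
                             > M * real n powr (- \<beta> / (2 * \<beta> + 1))}
                     \<partial>(data_law \<sigma> n (fseries \<theta>star)))
                 \<longlonglongrightarrow> 0)))"
proof (rule exI[of _ 10], intro conjI allI impI ballI)
  fix g :: "real \<Rightarrow> real" and \<beta> :: real and \<theta>star
  assume "mono_on {1..} g \<and> slowly_varying g \<and> bdd_above (g ` {1..}) \<and> (\<forall>\<^sub>F x in at_top. 10 \<le> g x)"
  then have mono: "mono_on {1..} g" and bdd: "bdd_above (g ` {1..})" and ev10: "\<forall>\<^sub>F x in at_top. 10 \<le> g x"
    by auto
  assume \<beta>: "1 / 2 < \<beta>" and \<theta>: "\<theta>star \<in> sobolev \<beta>"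
  obtain U where U: "\<And>x. 1 \<le> x \<Longrightarrow> g x \<le> U" using bdd unfolding bdd_above_def by auto
  obtain X where X: "\<And>x. X \<le> x \<Longrightarrow> 10 \<le> g x" using ev10 unfolding eventually_at_top_linorder by auto
  \<comment> \<open>Monotonicity bounds \<open>g\<close> below by \<open>g 1\<close>, boundedness
    bounds it above by \<open>U\<close>.\<close>
  define G where "G = max \<bar>U\<bar> \<bar>g 1\<bar>"
  have G: "\<bar>g (real s)\<bar> \<le> G" if "1 \<le> s" for s :: nat
    using U[of "real s"] mono_onD[OF mono, of 1 "real s"] that unfolding G_def by auto
  have G0: "G \<ge> 0" by (simp add: G_def)
  define lk where "lk = 1 / (2 * \<gamma> * \<sigma>\<^sup>2)"
  have lk0: "lk \<ge> 0" using assms by (simp add: lk_def)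
  \<comment> \<open>With \<open>m = K * S\<close>, the penalty excess beyond \<open>m\<close>
    outweighs everything lost by comparing with \<open>S\<close>.\<close>
  obtain K :: nat where K: "max 1 (G + lk + 1 / \<sigma>\<^sup>2) \<le> real K" using real_arch_simple by blast
  have K1: "1 \<le> real K" "G + lk + 1 / \<sigma>\<^sup>2 \<le> real K" using K by auto
  define r where "r n = real n powr (1 / (2 * \<beta> + 1))" for n
  have rtop: "filterlim r at_top sequentially"
    unfolding r_def using \<beta> by real_asymp
  show "\<exists>M>0. \<forall>\<alpha>. 0 < \<alpha> \<and> \<alpha> < 1 \<longrightarrow>
             (\<forall>Prior \<in> {type1_prior \<sigma> \<gamma> g \<alpha>, type2_prior \<sigma> \<gamma> g \<alpha>}.
               ((\<lambda>n. \<integral>\<^sup>+ Y. posterior \<sigma> n Y (Prior n Y)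
                       {\<theta>. emp_norm n (\<lambda>t. fseries \<theta> t - fseries \<theta>star t)
                             > M * real n powr (- \<beta> / (2 * \<beta> + 1))}
                     \<partial>(data_law \<sigma> n (fseries \<theta>star)))
                 \<longlonglongrightarrow> 0))"
  proof (rule exI[of _ 1], intro conjI allI impI ballI)
    fix \<alpha> :: real and Prior
    assume "0 < \<alpha> \<and> \<alpha> < 1" and Prior: "Prior \<in> {type1_prior \<sigma> \<gamma> g \<alpha>, type2_prior \<sigma> \<gamma> g \<alpha>}"
    then have \<alpha>: "0 < \<alpha>" "\<alpha> < 1" by auto
    \<comment> \<open>\<open>C1\<close> to \<open>C4\<close> are the ratios \<open>r / m\<close>
      required by the first four numerical hypotheses of \<open>expected_posterior_le\<close>; their
      sum \<open>C\<close> serves all of them.\<close>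
    define C1 where "C1 = 8 + 128 * \<sigma>\<^sup>2"
    define C2 where "C2 = 32 / \<gamma> * (1 + lk)"
    define C3 where "C3 = 32 * (1 / 2 + 8 * \<sigma>\<^sup>2)"
    define C4 where "C4 = 128 * \<sigma>\<^sup>2 / \<alpha> * (2 * G + lk)"
    define C where "C = C1 + C2 + C3 + C4"
    have Ci: "C1 \<ge> 8" "C2 \<ge> 0" "C3 \<ge> 0" "C4 \<ge> 0"
      using assms \<alpha> lk0 G0 by (auto simp: C1_def C2_def C3_def C4_def)
    have C: "C \<ge> 8" "C1 \<le> C" "C2 \<le> C" "C3 \<le> C" "C4 \<le> C" using Ci by (auto simp: C_def)
    \<comment> \<open>Rounding at most doubles \<open>\<delta> * r\<close>, so
      \<open>C * m \<le> C * K * (2 * \<delta> * r) = r\<close>. Only here, through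
      \<open>C4\<close>, does \<alpha> influence the size; the radius is unaffected.\<close>
    define \<delta> where "\<delta> = 1 / (2 * real K * C)"
    have \<delta>: "\<delta> > 0" using K1 C by (simp add: \<delta>_def)
    define c where "c = min (\<gamma> / 32) (\<alpha> / (128 * \<sigma>\<^sup>2))"
    have c: "c > 0" using assms \<alpha> by (simp add: c_def)
    define S where "S n = nat \<lceil>\<delta> * r n\<rceil>" for n
    define m where "m n = K * S n" for n
    let ?A = "\<lambda>n. {\<theta>. emp_norm n (\<lambda>t. fseries \<theta> t - fseries \<theta>star t) > 1 * real n powr (- \<beta> / (2 * \<beta> + 1))}"
    have ev1: "\<forall>\<^sub>F n in sequentially. resid n (\<lambda>i. fseries \<theta>star (design n i)) (S n) \<le> \<delta> * r n"
      unfolding S_def r_def by (rule bias_small[OF \<beta> \<theta> \<delta>])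
    have "filterlim (\<lambda>n. \<delta> * r n) at_top sequentially"
      by (rule filterlim_tendsto_pos_mult_at_top[OF tendsto_const \<delta> rtop])
    \<comment> \<open>The bound 1 makes the ceiling at most a doubling; the bound \<open>X\<close>
      puts every size above \<open>m n\<close> in the range where \<open>g\<close> is at least
      10.\<close>
    then have ev2: "\<forall>\<^sub>F n in sequentially. max 1 X \<le> \<delta> * r n"
      unfolding filterlim_at_top by blast
    have le: "\<forall>\<^sub>F n in sequentially. (\<integral>\<^sup>+ Y. posterior \<sigma> n Y (Prior n Y) (?A n) \<partial>(data_law \<sigma> n (fseries \<theta>star)))
        \<le> ennreal (r n * exp (- c * r n) + 4 * exp (- \<delta> * r n))"
      using ev1 ev2 eventually_gt_at_top[of 0]
    proof eventually_elim
      case (elim n)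
      have S1: "1 \<le> S n" "\<delta> * r n \<le> real (S n)" "real (S n) \<le> 2 * (\<delta> * r n)"
        using elim(2) unfolding S_def by linarith+
      have Sm: "S n \<le> m n" using K1(1) by (simp add: m_def)
      have Cm: "C * real (m n) \<le> r n"
      proof -
        have "C * real (m n) \<le> C * (real K * (2 * (\<delta> * r n)))"
          unfolding m_def of_nat_mult using S1(3) C by (intro mult_left_mono) auto
        also have "\<dots> = r n" using K1(1) C by (simp add: \<delta>_def)
        finally show ?thesis .
      qed
      have Cim: "k * real (m n) \<le> r n" if "k \<le> C" for k
        using mult_right_mono[OF that, of "real (m n)"] Cm by simp
      have mr: "real (m n) \<le> r n" using Cim[of 1] C by simp
      have "r n \<le> real n powr 1" unfolding r_def using elim(3) \<beta> by (intro powr_mono) auto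
      then have mn: "m n \<le> n" using mr by simp
      have h2: "(1 + lk) * real (m n) \<le> \<gamma> * r n / 32"
      proof -
        have "\<gamma> / 32 * (C2 * real (m n)) \<le> \<gamma> / 32 * r n" using Cim[OF C(3)] assms by (intro mult_left_mono) auto
        moreover have "\<gamma> / 32 * (C2 * real (m n)) = (1 + lk) * real (m n)"
        proof -
          have "\<gamma> / 32 * (32 / \<gamma>) = 1" using assms(2) by simp
          then show ?thesis unfolding C2_def by (simp only: mult.assoc[symmetric] mult_1_left)
        qed
        ultimately show ?thesis by (simp only: times_divide_eq_left)
      qed
      have h4: "(2 * G + lk) * real (m n) \<le> \<alpha> * r n / (128 * \<sigma>\<^sup>2)"
      proof -
        have "\<alpha> / (128 * \<sigma>\<^sup>2) * (C4 * real (m n)) \<le> \<alpha> / (128 * \<sigma>\<^sup>2) * r n"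
          using Cim[OF C(5)] assms \<alpha> by (intro mult_left_mono) auto
        moreover have "\<alpha> / (128 * \<sigma>\<^sup>2) * (C4 * real (m n)) = (2 * G + lk) * real (m n)"
        proof -
          have "\<alpha> / (128 * \<sigma>\<^sup>2) * (128 * \<sigma>\<^sup>2 / \<alpha>) = 1" using assms(1) \<alpha>(1) by simp
          then show ?thesis unfolding C4_def by (simp only: mult.assoc[symmetric] mult_1_left)
        qed
        ultimately show ?thesis by (simp only: times_divide_eq_left)
      qed
      have far: "r n < (\<Sum>i=1..n. (fseries \<theta>star (design n i) - (\<Sum>j=1..s. x j * fourier j (design n i)))\<^sup>2)"
        if "pad s x \<in> ?A n" for s x
      proof -
        define Q where "Q = (\<Sum>i=1..n. (fseries \<theta>star (design n i) - (\<Sum>j=1..s. x j * fourier j (design n i)))\<^sup>2)"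
        have "real n powr (- \<beta> / (2 * \<beta> + 1)) < sqrt (Q / real n)"
          using that unfolding emp_norm_def Q_def by (simp add: power2_commute fseries_pad)
        then have "(real n powr (- \<beta> / (2 * \<beta> + 1)))\<^sup>2 < (sqrt (Q / real n))\<^sup>2"
          by (intro power_strict_mono) auto
        also have "\<dots> = Q / real n" by (simp add: Q_def sum_nonneg)
        finally have "real n * (real n powr (- \<beta> / (2 * \<beta> + 1)))\<^sup>2 < Q"
          using elim(3) by (simp add: pos_less_divide_eq mult.commute)
        \<comment> \<open>The squared radius times \<open>n\<close> is exactly \<open>r n\<close>,
          which is why the radius constant can be 1.\<close>
        moreover have "real n * (real n powr (- \<beta> / (2 * \<beta> + 1)))\<^sup>2 = r n"
        proof -
          have "real n * (real n powr (- \<beta> / (2 * \<beta> + 1)))\<^sup>2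
            = real n powr 1 * real n powr (2 * (- \<beta> / (2 * \<beta> + 1)))"
            using elim(3) by (simp add: power2_eq_square powr_add[symmetric])
          also have "\<dots> = real n powr (1 + 2 * (- \<beta> / (2 * \<beta> + 1)))" by (rule powr_add[symmetric])
          also have "1 + 2 * (- \<beta> / (2 * \<beta> + 1)) = 1 / (2 * \<beta> + 1)" using \<beta> by (simp add: field_simps)
          finally show ?thesis by (simp add: r_def)
        qed
        ultimately show ?thesis unfolding Q_def by simp
      qed
      have "(\<integral>\<^sup>+ Y. posterior \<sigma> n Y (Prior n Y) (?A n) \<partial>(data_law \<sigma> n (fseries \<theta>star)))
        \<le> ennreal (real (m n) * exp (- min (\<gamma> / 32) (\<alpha> / (128 * \<sigma>\<^sup>2)) * r n) + 4 * exp (- real (S n)))"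
      proof (rule expected_posterior_le[OF assms(1,2) \<alpha> S1(1) Sm mn Prior measurable_loss far G _ _ _ _ _ _ _, folded lk_def])
        show "10 \<le> g (real s)" if "m n < s" for s
        proof (rule X)
          have "X \<le> real (S n)" using elim(2) S1 by simp
          also have "\<dots> \<le> real s" using Sm that by simp
          finally show "X \<le> real s" .
        qed
        show "resid n (\<lambda>i. fseries \<theta>star (design n i)) (S n) \<le> real (S n)" using elim(1) S1(2) by simp
        show "(8 + 128 * \<sigma>\<^sup>2) * real (m n) \<le> r n" using Cim[OF C(2)] by (simp add: C1_def)
        show "(1 / 2 + 8 * \<sigma>\<^sup>2) * real (m n) \<le> r n / 32" 
          using Cim[OF C(4)] unfolding C3_def mult.assoc by linarith
        show "(G + lk + 1 / \<sigma>\<^sup>2) * real (S n) \<le> real (m n)"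
          using K1(2) by (simp add: m_def mult_right_mono)
        show "(1 + lk) * real (m n) \<le> \<gamma> * r n / 32" by (rule h2)
        show "(2 * G + lk) * real (m n) \<le> \<alpha> * r n / (128 * \<sigma>\<^sup>2)" by (rule h4)
      qed
      also have "\<dots> \<le> ennreal (r n * exp (- c * r n) + 4 * exp (- \<delta> * r n))"
        unfolding c_def[symmetric] using mr S1(2) by (intro ennreal_leI add_mono mult_right_mono) auto
      finally show ?case .
    qed
    have lim: "(\<lambda>n. ennreal (r n * exp (- c * r n) + 4 * exp (- \<delta> * r n))) \<longlonglongrightarrow> ennreal 0"
    proof (rule tendsto_ennrealI)
      have 1: "((\<lambda>x. x * exp (- (c * x))) \<longlongrightarrow> 0) at_top" using c by real_asymp
      have 2: "((\<lambda>x. 4 * exp (- (\<delta> * x))) \<longlongrightarrow> 0) at_top" using \<delta> by real_asymp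
      have "((\<lambda>x. x * exp (- c * x) + 4 * exp (- \<delta> * x)) \<longlongrightarrow> 0) at_top"
        using tendsto_add_zero[OF 1 2] by simp
      then show "(\<lambda>n. r n * exp (- c * r n) + 4 * exp (- \<delta> * r n)) \<longlonglongrightarrow> 0"
        using rtop by (rule filterlim_compose)
    qed
    show "(\<lambda>n. \<integral>\<^sup>+ Y. posterior \<sigma> n Y (Prior n Y) (?A n) \<partial>(data_law \<sigma> n (fseries \<theta>star))) \<longlonglongrightarrow> 0"
      by (rule tendsto_sandwich[OF _ le tendsto_const lim[unfolded ennreal_0]]) simp
  qed simp
qed simp

end
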